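(* Let $A\in\mathbb{R}^{2n\times 2n}$ be a symmetric positive-semidefinite matrix whose kernel is a symplectic subspace of $\mathbb{R}^{2n}$ of dimension $2m$, where $0\le m<n$. Let $W=[W_1\ W_2]$ with $W_1,W_2\in\mathbb{R}^{2n\times m}$ be a matrix satisfying $W^TJ_{2n}W=J_{2m}$ whose columns form a basis of $\ker A$. Let $A^{1/2}$ be the unique symmetric positive-semidefinite square root of $A$, and let $Q\in\mathbb{R}^{2n\times 2n}$ be an orthogonal matrix such that $$Q^TA^{1/2}J_{2n}A^{1/2}Q=\mathrm{diag}\left(0_{2\times2},\ldots,0_{2\times2},\begin{bmatrix}0&d_{m+1}\\ -d_{m+1}&0\end{bmatrix},\ldots,\begin{bmatrix}0&d_n\\ -d_n&0\end{bmatrix}\right)$$ with $m$ zero blocks of size $2\times 2$ and $0<d_{m+1}\le\cdots\le d_n$ (such $W$ and $Q$ exist). Let $P=[e_1,e_3,\ldots,e_{2n-1},e_2,e_4,\ldots,e_{2n}]$, where $e_j$ is the $j$-th canonical unit vector of $\mathbb{R}^{2n}$, let $E=\mathrm{diag}(1/\sqrt{d_{m+1}},\ldots,1/\sqrt{d_n})\in\mathbb{R}^{(n-m)\times(n-m)}$, and set $$\tilde S=J_{2n}A^{1/2}QP\begin{bmatrix} 0_{m\times(n-m)} & 0_{m\times(n-m)} \\ 0_{(n-m)\times(n-m)} & -E \\ 0_{m\times(n-m)} & 0_{m\times(n-m)} \\ E & 0_{(n-m)\times(n-m)} \end{bmatrix}=[\tilde S_1\ \tilde S_2],\qquad \tilde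 S_1,\tilde S_2\in\mathbb{R}^{2n\times(n-m)}.$$ Then the matrix $S=[W_1\ \tilde S_1\ W_2\ \tilde S_2]\in\mathbb{R}^{2n\times 2n}$ is symplectic, i.e. $S^TJ_{2n}S=J_{2n}$, and $$S^TAS=\begin{bmatrix} D & 0 \\ 0 & D \end{bmatrix},$$ where $D=\mathrm{diag}(d_1,\ldots,d_n)$ with $0=d_1=\cdots=d_m<d_{m+1}\le\cdots\le d_n$.
   Context: For a positive integer $n$, $J_{2n}=\begin{bmatrix} 0 & I_n \\ -I_n & 0 \end{bmatrix}\in\mathbb{R}^{2n\times2n}$, where $I_n$ is the $n\times n$ identity matrix. A subspace $\mathbb{U}\subset\mathbb{R}^{2n}$ is called symplectic if for every $x\in\mathbb{U}\setminus\{0\}$ there exists $y\in\mathbb{U}$ such that $x^TJ_{2n}y=1$; the trivial subspace $\{0\}$ is symplectic. When $m=0$, the blocks $W_1,W_2$ and the zero blocks with $m$ rows are empty. *)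

theory Defs
  imports "Jordan_Normal_Form.Matrix_Kernel"
begin

text \<open>
  Matrices and vectors are those of Jordan_Normal_Form: the dimensions are ordinary natural
  numbers, may be 0 (empty blocks), and rows and columns are indexed from 0, so that the
  \<open>j\<close>-th canonical unit vector of \<open>\<real>\<^sup>N\<close> is \<open>unit_vec N (j - 1)\<close>.
\<close>

definition append_cols :: "'a :: zero mat \<Rightarrow> 'a mat \<Rightarrow> 'a mat"  (infixr \<open>@\<^sub>c\<close> 65) where
  "A @\<^sub>c B = mat_of_cols (dim_row A) (cols A @ cols B)"

text \<open>The argument of \<open>J_mat\<close> is the half dimension: \<open>J_mat n\<close> is $J_{2n}$.\<close>

definition J_mat :: "nat \<Rightarrow> real mat" where
  "J_mat n = four_block_mat (0\<^sub>m n n) (1\<^sub>m n) (- 1\<^sub>m n) (0\<^sub>m n n)"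

definition symplectic_subspace :: "nat \<Rightarrow> real vec set \<Rightarrow> bool" where
  "symplectic_subspace n U \<longleftrightarrow>
     subspace class_ring U (module_vec TYPE(real) (2 * n)) \<and>
     (\<forall>x \<in> U - {0\<^sub>v (2 * n)}. \<exists>y \<in> U. x \<bullet> (J_mat n *\<^sub>v y) = 1)"

definition symplectic_mat :: "nat \<Rightarrow> real mat \<Rightarrow> bool" where
  "symplectic_mat n S \<longleftrightarrow> S \<in> carrier_mat (2 * n) (2 * n) \<and> S\<^sup>T * J_mat n * S = J_mat n"

definition sym_psd_mat :: "nat \<Rightarrow> real mat \<Rightarrow> bool" where
  "sym_psd_mat N A \<longleftrightarrow>
     A \<in> carrier_mat N N \<and> A\<^sup>T = A \<and> (\<forall>x \<in> carrier_vec N. 0 \<le> x \<bullet> (A *\<^sub>v x))"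

text \<open>Meaningful only for symmetric positive-semidefinite \<open>A\<close>, where the root exists uniquely.\<close>

definition psd_sqrt :: "real mat \<Rightarrow> real mat" where
  "psd_sqrt A = (THE R. sym_psd_mat (dim_row A) R \<and> R * R = A)"

text \<open>The library's \<open>orthogonal_mat\<close> does not normalise the columns.\<close>

definition real_orthogonal_mat :: "nat \<Rightarrow> real mat \<Rightarrow> bool" where
  "real_orthogonal_mat N Q \<longleftrightarrow> Q \<in> carrier_mat N N \<and> Q\<^sup>T * Q = 1\<^sub>m N \<and> Q * Q\<^sup>T = 1\<^sub>m N"

text \<open>
  \<open>W = [W1 W2]\<close> satisfies $W^T J_{2n} W = J_{2m}$ and its columns form a basis of the kernel of
  \<open>A\<close>. As \<open>kernel.basis\<close> speaks about sets of vectors, distinctness of the columns is required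
  separately.
\<close>

definition symplectic_kernel_basis ::
    "nat \<Rightarrow> nat \<Rightarrow> real mat \<Rightarrow> real mat \<Rightarrow> real mat \<Rightarrow> bool" where
  "symplectic_kernel_basis n m A W1 W2 \<longleftrightarrow>
     W1 \<in> carrier_mat (2 * n) m \<and> W2 \<in> carrier_mat (2 * n) m \<and>
     (let W = W1 @\<^sub>c W2 in
        W\<^sup>T * J_mat n * W = J_mat m \<and>
        distinct (cols W) \<and> kernel.basis (2 * n) A (set (cols W)))"

definition skew_block :: "real \<Rightarrow> real mat" where
  "skew_block a = mat_of_rows_list 2 [[0, a], [- a, 0]]"

text \<open>
  The numbers \<open>d\<close> keep their original indices \<open>m + 1, \<dots>, n\<close>; the values of \<open>d\<close> elsewhere are
  irrelevant.
\<close>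

definition skew_normal_form ::
    "nat \<Rightarrow> nat \<Rightarrow> real mat \<Rightarrow> real mat \<Rightarrow> (nat \<Rightarrow> real) \<Rightarrow> bool" where
  "skew_normal_form n m A Q d \<longleftrightarrow>
     real_orthogonal_mat (2 * n) Q \<and>
     Q\<^sup>T * psd_sqrt A * J_mat n * psd_sqrt A * Q =
       diag_block_mat (replicate m (0\<^sub>m 2 2) @ map (\<lambda>i. skew_block (d i)) [m + 1..<n + 1]) \<and>
     (\<forall>i \<in> {m + 1..n}. 0 < d i) \<and> mono_on {m + 1..n} d"

text \<open>$P = [e_1, e_3, \ldots, e_{2n-1}, e_2, e_4, \ldots, e_{2n}]$\<close>

definition P_mat :: "nat \<Rightarrow> real mat" where
  "P_mat n = mat_of_cols (2 * n)
     (map (\<lambda>i. unit_vec (2 * n) (2 * i)) [0..<n] @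
      map (\<lambda>i. unit_vec (2 * n) (2 * i + 1)) [0..<n])"

definition E_mat :: "nat \<Rightarrow> nat \<Rightarrow> (nat \<Rightarrow> real) \<Rightarrow> real mat" where
  "E_mat n m d = mat_diag (n - m) (\<lambda>i. 1 / sqrt (d (m + 1 + i)))"

text \<open>\<open>@\<^sub>r\<close> stacks the upper half (block rows 1, 2) on the lower half (block rows 3, 4).\<close>

definition S_tilde :: "nat \<Rightarrow> nat \<Rightarrow> real mat \<Rightarrow> real mat \<Rightarrow> (nat \<Rightarrow> real) \<Rightarrow> real mat" where
  "S_tilde n m A Q d =
     (let k = n - m; E = E_mat n m d in
      J_mat n * psd_sqrt A * Q * P_mat n *
        (four_block_mat (0\<^sub>m m k) (0\<^sub>m m k)
                        (0\<^sub>m k k) (- E)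
         @\<^sub>r
         four_block_mat (0\<^sub>m m k) (0\<^sub>m m k)
                        E         (0\<^sub>m k k)))"

definition S_mat ::
    "nat \<Rightarrow> nat \<Rightarrow> real mat \<Rightarrow> real mat \<Rightarrow> real mat \<Rightarrow> real mat \<Rightarrow> (nat \<Rightarrow> real) \<Rightarrow> real mat" where
  "S_mat n m A W1 W2 Q d =
     (let T = cols (S_tilde n m A Q d);
          S1 = mat_of_cols (2 * n) (take (n - m) T);
          S2 = mat_of_cols (2 * n) (drop (n - m) T)
      in W1 @\<^sub>c S1 @\<^sub>c W2 @\<^sub>c S2)"

text \<open>$D = \mathrm{diag}(0, \ldots, 0, d_{m+1}, \ldots, d_n)$\<close>

definition D_mat :: "nat \<Rightarrow> nat \<Rightarrow> (nat \<Rightarrow> real) \<Rightarrow> real mat" where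
  "D_mat n m d = mat_diag n (\<lambda>i. if i < m then 0 else d (i + 1))"

end

theory Submission
  imports Defs "HOL-Analysis.Function_Topology" "Jordan_Normal_Form.DL_Rank"
begin

text \<open>
  Write \<open>R\<close> for the square root of \<open>A\<close>, \<open>J\<close> for \<open>J_mat n\<close> and \<open>M = R J R\<close>, which is skew-symmetric. If
  \<open>M x = 0\<close>, then \<open>J R x\<close> lies in the kernel of \<open>R\<close>, which is that of \<open>A\<close>, and is
  \<open>J\<close>-orthogonal to it; as that kernel is symplectic, \<open>R x = 0\<close>. Hence \<open>M\<close> and \<open>A\<close> have the same
  kernel, and exactly \<open>m\<close> blocks of the normal form of \<open>M\<close> vanish. Both the spectral theorem and
  the skew normal form are obtained by repeatedly minimising a Rayleigh quotient over the unit
  vectors orthogonal to the vectors already found, so that the values come out sorted; for the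
  skew form the quotient is that of \<open>M\<^sup>T M\<close> and each minimiser \<open>x\<close> is paired with \<open>M x\<close>. The
  symplectic basis of the kernel is the normal form of the compression of \<open>J\<close> to the kernel, rescaled.
  The identities for \<open>S\<close> are then read off the columns: with \<open>q\<close>, \<open>q'\<close> columns of \<open>Q\<close>, the vectors
  \<open>J R q\<close> and \<open>J R q'\<close> pair to \<open>q \<bullet> M q'\<close> under \<open>J\<close> and to \<open>M q \<bullet> M q'\<close> under \<open>A\<close>, and
  both forms vanish between \<open>J R q\<close> and the kernel.
\<close>

section \<open>Minimising a quadratic form on a sphere\<close>

text \<open>Families are functions on \<open>nat\<close> of which only the values below
  \<open>k\<close> count, so a family is extended by the update \<open>q(k := x)\<close>.\<close>

definition orthonormal :: "nat \<Rightarrow> nat \<Rightarrow> (nat \<Rightarrow> real vec) \<Rightarrow> bool" where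
  "orthonormal N k q \<longleftrightarrow> (\<forall>i<k. q i \<in> carrier_vec N) \<and>
     (\<forall>i<k. \<forall>j<k. q i \<bullet> q j = (if i = j then 1 else 0))"

text \<open>The unit sphere of the orthogonal complement of the first \<open>k\<close> vectors,
  which is the domain of each minimisation.\<close>

definition unit_perp :: "nat \<Rightarrow> nat \<Rightarrow> (nat \<Rightarrow> real vec) \<Rightarrow> real vec set" where
  "unit_perp N k q = {x \<in> carrier_vec N. x \<bullet> x = 1 \<and> (\<forall>i<k. q i \<bullet> x = 0)}"

lemma scalar_prod_self_nonneg: "0 \<le> x \<bullet> (x :: real vec)"
  unfolding scalar_prod_def by (auto intro: sum_nonneg)

lemma scalar_prod_self_eq_0:
  assumes "x \<in> carrier_vec N" "x \<bullet> x = (0::real)"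
  shows "x = 0\<^sub>v N"
proof (rule eq_vecI)
  fix i assume "i < dim_vec (0\<^sub>v N :: real vec)"
  then have i: "i < N" by simp
  have "\<forall>i\<in>{0..<N}. x $ i * x $ i = 0"
    using assms unfolding scalar_prod_def by (subst (asm) sum_nonneg_eq_0_iff) auto
  with i show "x $ i = 0\<^sub>v N $ i" by auto
qed (use assms in auto)

lemma normalize_unit:
  assumes "x \<in> carrier_vec N" "x \<noteq> 0\<^sub>v N"
  obtains c where "(c :: real) \<noteq> 0" "(c \<cdot>\<^sub>v x) \<bullet> (c \<cdot>\<^sub>v x) = 1"
proof -
  have p: "0 < x \<bullet> x"
    using assms scalar_prod_self_eq_0 scalar_prod_self_nonneg[of x] by (metis less_eq_real_def)
  let ?c = "1 / sqrt (x \<bullet> x)"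
  have "(?c \<cdot>\<^sub>v x) \<bullet> (?c \<cdot>\<^sub>v x) = ?c * ?c * (x \<bullet> x)"
    using assms by simp
  also have "\<dots> = 1" using p by (simp add: field_simps)
  finally show thesis using that[of ?c] p by simp
qed

text \<open>Padding the \<open>k\<close> given vectors with zero rows gives a square matrix,
  singular because \<open>k < N\<close> leaves at least one zero row. A nonzero kernel vector,
  normalised, is orthogonal to all given vectors.\<close>

lemma unit_perp_nonempty:
  assumes k: "k < N" and q: "\<forall>i<k. q i \<in> carrier_vec N"
  shows "unit_perp N k q \<noteq> {}"
proof -
  let ?r = "\<lambda>i. if i < k then q i else 0\<^sub>v N"
  define M where "M = mat_of_rows N (map ?r [0..<N])"
  have M: "M \<in> carrier_mat N N" unfolding M_def by (rule carrier_matI) auto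
  have row: "row M i = ?r i" if "i < N" for i
    unfolding M_def using that q by (subst mat_of_rows_row) auto
  \<comment> \<open>\<open>M\<^sup>T\<close> applied to this unit vector is row \<open>k\<close> of
    \<open>M\<close>, the first padding row.\<close>
  have "M\<^sup>T *\<^sub>v unit_vec N k = 0\<^sub>v N"
  proof (rule eq_vecI)
    fix i assume "i < dim_vec (0\<^sub>v N :: real vec)"
    then have i: "i < N" by simp
    have "(M\<^sup>T *\<^sub>v unit_vec N k) $ i = M $$ (k, i)" using M i k by simp
    also have "\<dots> = row M k $ i" using M i k by simp
    finally show "(M\<^sup>T *\<^sub>v unit_vec N k) $ i = 0\<^sub>v N $ i" using row[OF k] i by simp
  qed (use M in auto)
  moreover have "unit_vec N k \<noteq> (0\<^sub>v N :: real vec)" using k by (metis index_unit_vec(1) index_zero_vec(1) zero_neq_one)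
  ultimately have "det M\<^sup>T = 0"
    using det_0_iff_vec_prod_zero[of "M\<^sup>T" N] M by (auto intro: exI[of _ "unit_vec N k"])
  then have "det M = 0" using det_transpose[OF M] by simp
  then obtain v where v: "v \<in> carrier_vec N" "v \<noteq> 0\<^sub>v N" "M *\<^sub>v v = 0\<^sub>v N"
    using det_0_iff_vec_prod_zero[OF M] by auto
  have orth: "q i \<bullet> v = 0" if "i < k" for i
  proof -
    have "q i \<bullet> v = (M *\<^sub>v v) $ i" using that k M row[of i] by simp
    then show ?thesis using v that k by simp
  qed
  obtain c where c: "c \<noteq> 0" "(c \<cdot>\<^sub>v v) \<bullet> (c \<cdot>\<^sub>v v) = 1"
    using normalize_unit[OF v(1,2)] by auto
  have "c \<cdot>\<^sub>v v \<in> unit_perp N k q"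
    unfolding unit_perp_def using c v orth q by auto
  then show ?thesis by auto
qed

text \<open>The quadratic form is continuous and the sphere is compact, so the minimum is
  attained.\<close>

lemma unit_perp_min_exists:
  assumes k: "k < N" and q: "\<forall>i<k. q i \<in> carrier_vec N" and B: "B \<in> carrier_mat N N"
  obtains x where "x \<in> unit_perp N k q"
    "\<And>y. y \<in> unit_perp N k q \<Longrightarrow> x \<bullet> (B *\<^sub>v x) \<le> y \<bullet> (B *\<^sub>v y)"
proof -
  \<comment> \<open>Vectors of variable dimension carry no topology, so compactness is taken from the product
     topology on sequences that vanish from index \<open>N\<close> on.\<close>
  define box :: "(nat \<Rightarrow> real) set" where
    "box = (\<Pi>\<^sub>E i\<in>UNIV. if i < N then {-1..1} else {0})"
  have cbox: "compact box"
  proof -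
    have "compactin (product_topology (\<lambda>i. euclidean) UNIV) box"
      unfolding box_def compactin_PiE by auto
    then show ?thesis by (simp add: euclidean_product_topology)
  qed
  \<comment> \<open>The sequences that encode \<open>unit_perp N k q\<close>, cut out of the compact
    \<open>box\<close> by closed conditions.\<close>
  define T where "T = box \<inter> ({f. (\<Sum>j\<in>{0..<N}. f j * f j) = 1} \<inter>
    (\<Inter>i\<in>{..<k}. {f. (\<Sum>j\<in>{0..<N}. q i $ j * f j) = 0}))"
  have "compact T"
    unfolding T_def
    by (intro compact_Int_closed[OF cbox] closed_Int closed_INT ballI closed_Collect_eq
        continuous_intros continuous_on_product_coordinates)
  moreover have sub: "(\<lambda>i. if i < N then x $ i else 0) \<in> T" if x: "x \<in> unit_perp N k q" for x
  proof -
    have xc: "x \<in> carrier_vec N" and 1: "(\<Sum>j\<in>{0..<N}. x $ j * x $ j) = 1"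
      and orth: "\<And>i. i < k \<Longrightarrow> (\<Sum>j\<in>{0..<N}. q i $ j * x $ j) = 0"
      using x by (auto simp: unit_perp_def scalar_prod_def)
    have "\<bar>x $ i\<bar> \<le> 1" if "i < N" for i
    proof -
      have "x $ i * x $ i \<le> (\<Sum>j\<in>{0..<N}. x $ j * x $ j)"
        using that by (intro member_le_sum) auto
      then have "(x $ i)\<^sup>2 \<le> 1" using 1 by (simp add: power2_eq_square)
      then show ?thesis by (simp add: abs_square_le_1)
    qed
    then show ?thesis using 1 orth by (auto simp: T_def box_def abs_le_iff)
  qed
  moreover have "T \<noteq> {}" using unit_perp_nonempty[OF k q] sub by blast
  moreover define F where "F = (\<lambda>f. \<Sum>i\<in>{0..<N}. f i * (\<Sum>j\<in>{0..<N}. B $$ (i, j) * (f j :: real)))"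
  have "continuous_on T F"
    unfolding F_def by (intro continuous_intros continuous_on_product_coordinates
        continuous_on_subset[OF continuous_on_product_coordinates subset_UNIV])
  ultimately obtain f where f: "f \<in> T" "\<And>g. g \<in> T \<Longrightarrow> F f \<le> F g"
    using continuous_attains_inf[of T F] by blast
  have quad: "x \<bullet> (B *\<^sub>v x) = F (\<lambda>i. if i < N then x $ i else 0)" if "x \<in> carrier_vec N" for x
    using that B unfolding F_def scalar_prod_def by (auto simp: scalar_prod_def intro!: sum.cong)
  \<comment> \<open>A sequence in \<open>box\<close> vanishes from \<open>N\<close> on, so cutting
    it to a vector and padding with zeros gives it back.\<close>
  have ff: "(\<lambda>i. if i < N then vec N f $ i else 0) = f"
    using f(1) by (auto simp: T_def box_def PiE_iff fun_eq_iff split: if_splits)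
  have "vec N f \<in> unit_perp N k q"
    using f(1) by (auto simp: T_def unit_perp_def scalar_prod_def)
  moreover have "vec N f \<bullet> (B *\<^sub>v vec N f) \<le> y \<bullet> (B *\<^sub>v y)" if "y \<in> unit_perp N k q" for y
    using quad[of "vec N f"] quad[of y] f(2)[OF sub[OF that]] that ff by (auto simp: unit_perp_def)
  ultimately show thesis using that by blast
qed

section \<open>Adjoints and the first-order condition at a minimum\<close>

lemma scalar_prod_mult_mat_vec:
  assumes "B \<in> carrier_mat N M" "x \<in> carrier_vec N" "y \<in> carrier_vec M"
  shows "x \<bullet> (B *\<^sub>v y) = (B\<^sup>T *\<^sub>v x) \<bullet> (y :: real vec)"
  using transpose_vec_mult_scalar[OF assms(1,3,2)] by simp

lemma sym_mat_scalar_prod: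
  assumes "B \<in> carrier_mat N N" "B\<^sup>T = B" "x \<in> carrier_vec N" "y \<in> carrier_vec N"
  shows "x \<bullet> (B *\<^sub>v y) = y \<bullet> (B *\<^sub>v (x :: real vec))"
  using scalar_prod_mult_mat_vec[OF assms(1,3,4)] assms
  by (metis comm_scalar_prod mult_mat_vec_carrier)

lemma neg_vec_eq_smult:
  assumes "w \<in> carrier_vec N" "x \<in> carrier_vec N" "- w = l \<cdot>\<^sub>v (x :: real vec)"
  shows "w = (- l) \<cdot>\<^sub>v x"
proof (rule eq_vecI)
  fix i assume "i < dim_vec ((- l) \<cdot>\<^sub>v x)"
  then have i: "i < N" using assms by simp
  have "(- w) $ i = (l \<cdot>\<^sub>v x) $ i" by (simp only: assms(3))
  then show "w $ i = ((- l) \<cdot>\<^sub>v x) $ i" using i assms(1,2) by simp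
qed (use assms in auto)

text \<open>A step against the linear term decides: with \<open>s = |b| + 1\<close> and
  \<open>t = - a / s\<close> the expression equals \<open>a^2 / s^2 * (b - 2 * s)\<close>, which is
  negative unless \<open>a = 0\<close>.\<close>

lemma linear_le_quadratic_imp_zero:
  fixes a b :: real
  assumes "0 \<le> a" "\<And>t. 0 \<le> 2 * t * a + t\<^sup>2 * b"
  shows "a = 0"
proof (rule ccontr)
  assume "a \<noteq> 0"
  then have a: "0 < a" using assms(1) by simp
  define s where "s = \<bar>b\<bar> + 1"
  have s: "0 < s" by (simp add: s_def)
  have "0 \<le> 2 * (- a / s) * a + (- a / s)\<^sup>2 * b" by (rule assms(2))
  also have "\<dots> = a\<^sup>2 / s\<^sup>2 * (b - 2 * s)"
    using s by (simp add: field_simps power2_eq_square)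
  finally have "0 \<le> b - 2 * s"
    using a s by (simp add: zero_le_mult_iff divide_simps split: if_splits)
  then show False by (simp add: s_def)
qed

text \<open>This is the Lagrange multiplier argument. Because the \<open>q i\<close> are
  eigenvectors of the symmetric \<open>B\<close>, the residual \<open>B x - l x\<close> stays in
  their orthogonal complement, and minimality along that direction forces it to vanish. The lower
  bound \<open>l\<close> is kept so that successive eigenvalues can be compared.\<close>

lemma unit_perp_min_eigenvector:
  assumes k: "k < N" and q: "\<forall>i<k. q i \<in> carrier_vec N"
    and B: "B \<in> carrier_mat N N" and sym: "B\<^sup>T = B"
    and eig: "\<forall>i<k. B *\<^sub>v q i = c i \<cdot>\<^sub>v q i"
  obtains x l where "x \<in> unit_perp N k q" "B *\<^sub>v x = l \<cdot>\<^sub>v x"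
    "\<And>y. y \<in> unit_perp N k q \<Longrightarrow> l \<le> y \<bullet> (B *\<^sub>v y)"
proof -
  obtain x where x: "x \<in> unit_perp N k q"
    and min: "\<And>y. y \<in> unit_perp N k q \<Longrightarrow> x \<bullet> (B *\<^sub>v x) \<le> y \<bullet> (B *\<^sub>v y)"
    using unit_perp_min_exists[OF k q B] by blast
  have xc: "x \<in> carrier_vec N" and xx: "x \<bullet> x = 1" and xq: "\<And>i. i < k \<Longrightarrow> q i \<bullet> x = 0"
    using x by (auto simp: unit_perp_def)
  define l where "l = x \<bullet> (B *\<^sub>v x)"
  \<comment> \<open>Scaling extends minimality from unit vectors to the whole complement, so that
    \<open>x + t \<cdot>\<^sub>v h\<close> below need not be normalised.\<close>
  have ge: "l * (y \<bullet> y) \<le> y \<bullet> (B *\<^sub>v y)"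
    if y: "y \<in> carrier_vec N" and yq: "\<And>i. i < k \<Longrightarrow> q i \<bullet> y = 0" for y
  proof (cases "y = 0\<^sub>v N")
    case True
    then show ?thesis using B by simp
  next
    case False
    obtain e where e: "e \<noteq> 0" "(e \<cdot>\<^sub>v y) \<bullet> (e \<cdot>\<^sub>v y) = 1"
      using normalize_unit[OF y False] by auto
    have "e \<cdot>\<^sub>v y \<in> unit_perp N k q" using e y yq q by (auto simp: unit_perp_def)
    then have "l \<le> (e \<cdot>\<^sub>v y) \<bullet> (B *\<^sub>v (e \<cdot>\<^sub>v y))" using min l_def by blast
    also have "\<dots> = e\<^sup>2 * (y \<bullet> (B *\<^sub>v y))"
      using y B by (simp add: mult_mat_vec power2_eq_square)
    finally have "l * 1 \<le> e\<^sup>2 * (y \<bullet> (B *\<^sub>v y))" by simp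
    moreover have "1 = e\<^sup>2 * (y \<bullet> y)" using e y by (simp add: power2_eq_square)
    ultimately have "e\<^sup>2 * (l * (y \<bullet> y)) \<le> e\<^sup>2 * (y \<bullet> (B *\<^sub>v y))" by (metis mult.left_commute)
    then show ?thesis using e(1) by simp
  qed
  \<comment> \<open>\<open>h\<close> is itself orthogonal to the \<open>q i\<close>, so it is an admissible variation of \<open>x\<close>.\<close>
  define h where "h = B *\<^sub>v x + (- l) \<cdot>\<^sub>v x"
  have Bx: "B *\<^sub>v x \<in> carrier_vec N" using B xc by simp
  have hc: "h \<in> carrier_vec N" unfolding h_def using Bx xc by simp
  have Bh: "B *\<^sub>v h \<in> carrier_vec N" using B hc by simp
  have hq: "q i \<bullet> h = 0" if "i < k" for i
  proof -
    have qi: "q i \<in> carrier_vec N" using q that by simp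
    have "q i \<bullet> (B *\<^sub>v x) = x \<bullet> (B *\<^sub>v q i)" by (rule sym_mat_scalar_prod[OF B sym qi xc])
    also have "\<dots> = c i * (x \<bullet> q i)" using eig that xc qi by simp
    also have "\<dots> = 0" using xq[OF that] comm_scalar_prod[OF xc qi] by simp
    finally show ?thesis unfolding h_def
      using scalar_prod_add_distrib[OF qi Bx, of "(- l) \<cdot>\<^sub>v x"] xq[OF that] xc qi by simp
  qed
  \<comment> \<open>The right side is half the coefficient of \<open>t\<close> when
    \<open>ge\<close> is expanded along \<open>x + t \<cdot>\<^sub>v h\<close>; the first-order
    condition therefore speaks about \<open>h \<bullet> h\<close>.\<close>
  have hh: "h \<bullet> h = h \<bullet> (B *\<^sub>v x) - l * (h \<bullet> x)"
    by (subst (2) h_def) (use scalar_prod_add_distrib[OF hc Bx, of "(- l) \<cdot>\<^sub>v x"] xc hc in simp)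
  have "h \<bullet> h = 0"
  proof (rule linear_le_quadratic_imp_zero[OF scalar_prod_self_nonneg])
    fix t :: real
    let ?y = "x + t \<cdot>\<^sub>v h"
    have yc: "?y \<in> carrier_vec N" and thc: "t \<cdot>\<^sub>v h \<in> carrier_vec N" using xc hc by auto
    have "l * (?y \<bullet> ?y) \<le> ?y \<bullet> (B *\<^sub>v ?y)"
    proof (rule ge[OF yc])
      fix i assume i: "i < k"
      then have "q i \<in> carrier_vec N" using q by simp
      then show "q i \<bullet> ?y = 0"
        using scalar_prod_add_distrib[OF _ xc thc] xq[OF i] hq[OF i] hc by simp
    qed
    moreover have "?y \<bullet> ?y = 1 + 2 * t * (h \<bullet> x) + t\<^sup>2 * (h \<bullet> h)"
      using xc hc thc xx comm_scalar_prod[OF xc hc]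
      by (simp add: add_scalar_prod_distrib[of _ N] scalar_prod_add_distrib[of _ N]
          algebra_simps power2_eq_square)
    moreover have "?y \<bullet> (B *\<^sub>v ?y) = l + 2 * t * (h \<bullet> (B *\<^sub>v x)) + t\<^sup>2 * (h \<bullet> (B *\<^sub>v h))"
    proof -
      have "B *\<^sub>v ?y = B *\<^sub>v x + t \<cdot>\<^sub>v (B *\<^sub>v h)"
        using B xc hc thc by (simp add: mult_add_distrib_mat_vec[OF B] mult_mat_vec[OF B])
      moreover have "t \<cdot>\<^sub>v (B *\<^sub>v h) \<in> carrier_vec N" using Bh by simp
      ultimately show ?thesis
        using xc hc thc Bx Bh sym_mat_scalar_prod[OF B sym xc hc]
        by (simp add: add_scalar_prod_distrib[of _ N] scalar_prod_add_distrib[of _ N]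
            algebra_simps power2_eq_square l_def)
    qed
    ultimately show "0 \<le> 2 * t * (h \<bullet> h) + t\<^sup>2 * (h \<bullet> (B *\<^sub>v h) - l * (h \<bullet> h))"
      unfolding hh by (simp add: algebra_simps)
  qed
  then have h0: "h = 0\<^sub>v N" using scalar_prod_self_eq_0[OF hc] by simp
  have "B *\<^sub>v x = l \<cdot>\<^sub>v x"
  proof (rule eq_vecI)
    fix i assume "i < dim_vec (l \<cdot>\<^sub>v x)"
    then have i: "i < N" using xc by simp
    have "h $ i = (B *\<^sub>v x) $ i - l * x $ i" unfolding h_def using i xc Bx by simp
    then show "(B *\<^sub>v x) $ i = (l \<cdot>\<^sub>v x) $ i" using h0 i xc by simp
  qed (use xc B in auto)
  then show thesis using that[OF x] min l_def by blast
qed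

section \<open>Spectral theorem and skew normal form\<close>

lemma orthonormal_Suc:
  assumes "orthonormal N k q" "x \<in> unit_perp N k q"
  shows "orthonormal N (Suc k) (q(k := x))"
  using assms comm_scalar_prod[of x N] by (auto simp: orthonormal_def unit_perp_def less_Suc_eq)

lemma unit_perp_Suc: "unit_perp N (Suc k) (q(k := x)) \<subseteq> unit_perp N k q"
  by (auto simp: unit_perp_def less_Suc_eq)

text \<open>The induction carries one extra clause: every eigenvalue found so far bounds the form
  from below on the remaining sphere. Applied to the next minimiser it gives the ordering, and it
  survives because the spheres shrink.\<close>

lemma orthonormal_eigenvectors_partial:
  assumes B: "B \<in> carrier_mat N N" and sym: "B\<^sup>T = B" and "k \<le> N"
  shows "\<exists>q c. orthonormal N k q \<and> (\<forall>i<k. B *\<^sub>v q i = c i \<cdot>\<^sub>v q i) \<and>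
    (\<forall>j<k. \<forall>i\<le>j. c i \<le> c j) \<and> (\<forall>i<k. \<forall>y \<in> unit_perp N k q. c i \<le> y \<bullet> (B *\<^sub>v y))"
  using \<open>k \<le> N\<close>
proof (induction k)
  case 0
  then show ?case by (simp add: orthonormal_def)
next
  case (Suc k)
  then obtain q c where on: "orthonormal N k q" and eig: "\<forall>i<k. B *\<^sub>v q i = c i \<cdot>\<^sub>v q i"
    and mono: "\<forall>j<k. \<forall>i\<le>j. c i \<le> c j"
    and low: "\<forall>i<k. \<forall>y \<in> unit_perp N k q. c i \<le> y \<bullet> (B *\<^sub>v y)"
    by auto
  have qc: "\<forall>i<k. q i \<in> carrier_vec N" using on by (simp add: orthonormal_def)
  have k: "k < N" using Suc.prems by simp
  obtain x l where x: "x \<in> unit_perp N k q" "B *\<^sub>v x = l \<cdot>\<^sub>v x"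
    and xmin: "\<And>y. y \<in> unit_perp N k q \<Longrightarrow> l \<le> y \<bullet> (B *\<^sub>v y)"
    using unit_perp_min_eigenvector[OF k qc B sym eig] by blast
  have xc: "x \<in> carrier_vec N" and xx: "x \<bullet> x = 1" using x by (auto simp: unit_perp_def)
  have cl: "c i \<le> l" if "i < k" for i
    using low x xx xc that by force
  let ?q = "q(k := x)" and ?c = "c(k := l)"
  have "orthonormal N (Suc k) ?q" by (rule orthonormal_Suc[OF on x(1)])
  moreover have "\<forall>i<Suc k. B *\<^sub>v ?q i = ?c i \<cdot>\<^sub>v ?q i" using eig x(2) by (auto simp: less_Suc_eq)
  moreover have "\<forall>j<Suc k. \<forall>i\<le>j. ?c i \<le> ?c j" using mono cl by (auto simp: less_Suc_eq)
  moreover have "\<forall>i<Suc k. \<forall>y \<in> unit_perp N (Suc k) ?q. ?c i \<le> y \<bullet> (B *\<^sub>v y)"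
    using low xmin unit_perp_Suc[of N k q x] by (auto simp: less_Suc_eq)
  ultimately show ?case by blast
qed

text \<open>Skewness gives \<open>M\<^sup>T * M = - (M * M)\<close>. A minimiser \<open>x\<close> of
  its form is an eigenvector with value \<open>l = |M x|^2\<close>, and \<open>x\<close> and
  \<open>M x\<close> span a plane that \<open>M\<close> maps into itself; it contributes one block
  with parameter \<open>sqrt l\<close>. The first \<open>2 * r\<close> vectors are prescribed kernel
  vectors, and injectivity on their complement makes every later \<open>l\<close> positive. The last
  clause is the invariant that orders the values \<open>d j\<close>.\<close>

lemma skew_normal_vectors:
  assumes M: "M \<in> carrier_mat N N" and skew: "M\<^sup>T = - M" and N: "2 * n \<le> N"
    and on0: "orthonormal N (2 * r) q0" and ker0: "\<forall>i<2*r. M *\<^sub>v q0 i = 0\<^sub>v N"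
    and inj: "\<forall>x \<in> unit_perp N (2 * r) q0. M *\<^sub>v x \<noteq> 0\<^sub>v N"
    and "r \<le> n"
  shows "\<exists>q d. orthonormal N (2 * n) q \<and> (\<forall>i<2*r. q i = q0 i) \<and>
    (\<forall>j\<in>{r..<n}. 0 < d j \<and> M *\<^sub>v q (2 * j) = (- d j) \<cdot>\<^sub>v q (2 * j + 1) \<and>
       M *\<^sub>v q (2 * j + 1) = d j \<cdot>\<^sub>v q (2 * j)) \<and>
    (\<forall>j\<in>{r..<n}. \<forall>i\<in>{r..j}. d i \<le> (d j :: real)) \<and>
    (\<forall>j\<in>{r..<n}. \<forall>y \<in> unit_perp N (2 * n) q. (d j)\<^sup>2 \<le> y \<bullet> (M\<^sup>T * M *\<^sub>v y))"
  using \<open>r \<le> n\<close> N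
proof (induction n rule: dec_induct)
  case base
  then show ?case using on0 by (intro exI[of _ q0] exI[of _ "\<lambda>_. 0"]) auto
next
  case (step k)
  then obtain q d where on: "orthonormal N (2 * k) q" and q0: "\<forall>i<2*r. q i = q0 i"
    and pair0: "\<forall>j\<in>{r..<k}. 0 < d j \<and> M *\<^sub>v q (2 * j) = (- d j) \<cdot>\<^sub>v q (2 * j + 1) \<and>
       M *\<^sub>v q (2 * j + 1) = d j \<cdot>\<^sub>v q (2 * j)"
    and mono: "\<forall>j\<in>{r..<k}. \<forall>i\<in>{r..j}. d i \<le> (d j :: real)"
    and low: "\<forall>j\<in>{r..<k}. \<forall>y \<in> unit_perp N (2 * k) q. (d j)\<^sup>2 \<le> y \<bullet> (M\<^sup>T * M *\<^sub>v y)"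
    by fastforce
  note pair = bspec[OF pair0]
  let ?B = "M\<^sup>T * M"
  have B: "?B \<in> carrier_mat N N" and symB: "?B\<^sup>T = ?B" using M by (auto simp: transpose_mult[of _ N N])
  have qc: "\<forall>i<2*k. q i \<in> carrier_vec N" using on by (simp add: orthonormal_def)
  have lt: "2 * k < N" using step.prems by simp
  have MT: "M\<^sup>T *\<^sub>v w = - (M *\<^sub>v w)" if "w \<in> carrier_vec N" for w
    unfolding skew using that M by (intro eq_vecI) auto
  have Bv: "?B *\<^sub>v y = - (M *\<^sub>v (M *\<^sub>v y))" if "y \<in> carrier_vec N" for y
    using assoc_mult_mat_vec[of "M\<^sup>T" N N M N y] that M MT by simp
  \<comment> \<open>Even positions are sent to multiples of their successor and odd ones to
    multiples of their predecessor; \<open>i div 2\<close> is the number of the pair.\<close>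
  have Mq: "M *\<^sub>v q i = (if i < 2 * r then 0\<^sub>v N else if even i then (- d (i div 2)) \<cdot>\<^sub>v q (i + 1)
      else d (i div 2) \<cdot>\<^sub>v q (i - 1))" if i: "i < 2 * k" for i
  proof (cases "i < 2 * r")
    case True
    then show ?thesis using q0 ker0 by simp
  next
    case False
    then have "i div 2 \<in> {r..<k}" using i by auto
    note p = pair[OF this]
    show ?thesis
    proof (cases "even i")
      case True
      then show ?thesis using p False by simp
    next
      case o: False
      then have e: "2 * (i div 2) + 1 = i" by presburger
      then have "2 * (i div 2) = i - 1" by simp
      then show ?thesis using p e o False by simp
    qed
  qed
  \<comment> \<open>Both members of a pair share one eigenvalue of \<open>M\<^sup>T * M\<close>, so
    the minimisation applies with the vectors found so far as constraints.\<close>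
  have eig: "\<forall>i<2*k. ?B *\<^sub>v q i = (if i < 2 * r then 0 else (d (i div 2))\<^sup>2) \<cdot>\<^sub>v q i"
  proof (intro allI impI)
    fix i assume i: "i < 2 * k"
    then have qi: "q i \<in> carrier_vec N" using qc by simp
    show "?B *\<^sub>v q i = (if i < 2 * r then 0 else (d (i div 2))\<^sup>2) \<cdot>\<^sub>v q i"
    proof (cases "i < 2 * r")
      case True
      then show ?thesis using Bv[OF qi] Mq[OF i] M qi by auto
    next
      case False
      then have j: "i div 2 \<in> {r..<k}" using i by auto
      have c: "q (2 * (i div 2)) \<in> carrier_vec N" "q (2 * (i div 2) + 1) \<in> carrier_vec N"
        using qc j by auto
      have "i = 2 * (i div 2) \<or> i = 2 * (i div 2) + 1" by presburger
      then have "?B *\<^sub>v q i = (d (i div 2))\<^sup>2 \<cdot>\<^sub>v q i"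
      proof
        assume e: "i = 2 * (i div 2)"
        have "M *\<^sub>v (M *\<^sub>v q (2 * (i div 2))) = - ((d (i div 2))\<^sup>2) \<cdot>\<^sub>v q (2 * (i div 2))"
          using pair[OF j] c M by (simp add: mult_mat_vec[OF M] smult_smult_assoc power2_eq_square)
        then have "M *\<^sub>v (M *\<^sub>v q i) = - ((d (i div 2))\<^sup>2) \<cdot>\<^sub>v q i" using e by metis
        then show ?thesis using Bv[OF qi] qi by auto
      next
        assume e: "i = 2 * (i div 2) + 1"
        have "M *\<^sub>v (M *\<^sub>v q (2 * (i div 2) + 1)) = - ((d (i div 2))\<^sup>2) \<cdot>\<^sub>v q (2 * (i div 2) + 1)"
          using pair[OF j] c M by (simp add: mult_mat_vec[OF M] smult_smult_assoc power2_eq_square)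
        then have "M *\<^sub>v (M *\<^sub>v q i) = - ((d (i div 2))\<^sup>2) \<cdot>\<^sub>v q i" using e by metis
        then show ?thesis using Bv[OF qi] qi by auto
      qed
      then show ?thesis using False by simp
    qed
  qed
  obtain x l where x: "x \<in> unit_perp N (2 * k) q" and Bx: "?B *\<^sub>v x = l \<cdot>\<^sub>v x"
    and xmin: "\<And>y. y \<in> unit_perp N (2 * k) q \<Longrightarrow> l \<le> y \<bullet> (?B *\<^sub>v y)"
    using unit_perp_min_eigenvector[OF lt qc B symB eig] by blast
  have xc: "x \<in> carrier_vec N" and xx: "x \<bullet> x = 1" and xq: "\<And>i. i < 2 * k \<Longrightarrow> q i \<bullet> x = 0"
    using x by (auto simp: unit_perp_def)
  have Mx: "M *\<^sub>v x \<in> carrier_vec N" using M xc by simp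
  have skewp: "u \<bullet> (M *\<^sub>v v) = - ((M *\<^sub>v u) \<bullet> v)" if "u \<in> carrier_vec N" "v \<in> carrier_vec N" for u v
    using scalar_prod_mult_mat_vec[OF M that] that M MT by simp
  have lMx: "l = (M *\<^sub>v x) \<bullet> (M *\<^sub>v x)"
  proof -
    have "l = x \<bullet> (?B *\<^sub>v x)" using Bx xx xc by simp
    also have "\<dots> = - (x \<bullet> (M *\<^sub>v (M *\<^sub>v x)))" using Bv[OF xc] xc Mx M by simp
    finally show ?thesis using skewp[OF xc Mx] by simp
  qed
  \<comment> \<open>The family extends \<open>q0\<close>, so \<open>x\<close> is orthogonal to
    \<open>q0\<close> too and the injectivity hypothesis applies.\<close>
  have "x \<in> unit_perp N (2 * r) q0"
    unfolding unit_perp_def using xc xx xq q0 step.hyps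
    by (auto simp flip: q0[rule_format])
  then have "M *\<^sub>v x \<noteq> 0\<^sub>v N" using inj by blast
  then have lpos: "0 < l"
    using scalar_prod_self_eq_0[OF Mx] scalar_prod_self_nonneg[of "M *\<^sub>v x"] lMx
    by (metis less_eq_real_def)
  define e where "e = sqrt l"
  have e: "0 < e" "e\<^sup>2 = l" using lpos by (auto simp: e_def)
  \<comment> \<open>The sign is chosen so that \<open>M\<close> acts on the pair \<open>x\<close>,
    \<open>z\<close> as the block with \<open>e\<close> above and \<open>- e\<close> below the
    diagonal.\<close>
  define z where "z = (- 1 / e) \<cdot>\<^sub>v (M *\<^sub>v x)"
  have zc: "z \<in> carrier_vec N" using Mx by (simp add: z_def)
  have Mxz: "M *\<^sub>v x = (- e) \<cdot>\<^sub>v z" using e Mx by (simp add: z_def smult_smult_assoc)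
  have Mz: "M *\<^sub>v z = e \<cdot>\<^sub>v x"
  proof -
    have "- (M *\<^sub>v (M *\<^sub>v x)) = l \<cdot>\<^sub>v x" using Bx Bv[OF xc] by simp
    then have "M *\<^sub>v (M *\<^sub>v x) = (- l) \<cdot>\<^sub>v x"
      using neg_vec_eq_smult[of "M *\<^sub>v (M *\<^sub>v x)" N x l] M Mx xc by simp
    then have "M *\<^sub>v z = (- 1 / e) \<cdot>\<^sub>v ((- l) \<cdot>\<^sub>v x)"
      unfolding z_def using Mx by (simp add: mult_mat_vec[OF M])
    then show ?thesis using e by (simp add: smult_smult_assoc power2_eq_square flip: e(2))
  qed
  have zz: "z \<bullet> z = 1"
    unfolding z_def using Mx lpos e by (simp add: power2_eq_square flip: lMx)
  have xMx: "x \<bullet> (M *\<^sub>v x) = 0" using skewp[OF xc xc] comm_scalar_prod[OF Mx xc] by simp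
  \<comment> \<open>By skewness this is \<open>- ((M *\<^sub>v q i) \<bullet> x)\<close>, and
    \<open>M *\<^sub>v q i\<close> is zero or a multiple of a vector already found, to which
    \<open>x\<close> is orthogonal.\<close>
  have qMx: "q i \<bullet> (M *\<^sub>v x) = 0" if i: "i < 2 * k" for i
  proof -
    have "(M *\<^sub>v q i) \<bullet> x = 0"
    proof -
      have "i + 1 < 2 * k" if "even i" using i that by presburger
      then show ?thesis unfolding Mq[OF i] using xq xc qc i by auto
    qed
    then show ?thesis using skewp[of "q i" x] qc i xc by simp
  qed
  let ?q = "(q(2 * k := x))(Suc (2 * k) := z)" and ?d = "d(k := e)"
  have z_perp: "z \<in> unit_perp N (Suc (2 * k)) (q(2 * k := x))"
    unfolding unit_perp_def using zc zz xMx qMx xc qc Mx by (auto simp: less_Suc_eq z_def)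
  have on': "orthonormal N (2 * Suc k) ?q"
    using orthonormal_Suc[OF orthonormal_Suc[OF on x] z_perp] by simp
  have sub: "unit_perp N (2 * Suc k) ?q \<subseteq> unit_perp N (2 * k) q"
    using unit_perp_Suc[of N "Suc (2 * k)" "q(2 * k := x)" z] unit_perp_Suc[of N "2 * k" q x] by auto
  \<comment> \<open>The invariant is evaluated at the new minimiser, where the form equals
    \<open>e\<^sup>2\<close>.\<close>
  have de: "d j \<le> e" if "j \<in> {r..<k}" for j
  proof -
    have "(d j)\<^sup>2 \<le> x \<bullet> (?B *\<^sub>v x)" using low that x by blast
    also have "\<dots> = e\<^sup>2" using Bx xx xc e by simp
    finally show ?thesis using e(1) power2_le_imp_le by fastforce
  qed
  have "\<forall>i<2*r. ?q i = q0 i" using q0 step.hyps by auto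
  moreover have "\<forall>j\<in>{r..<Suc k}. 0 < ?d j \<and> M *\<^sub>v ?q (2 * j) = (- ?d j) \<cdot>\<^sub>v ?q (2 * j + 1) \<and>
       M *\<^sub>v ?q (2 * j + 1) = ?d j \<cdot>\<^sub>v ?q (2 * j)"
  proof
    fix j assume j: "j \<in> {r..<Suc k}"
    show "0 < ?d j \<and> M *\<^sub>v ?q (2 * j) = (- ?d j) \<cdot>\<^sub>v ?q (2 * j + 1) \<and>
       M *\<^sub>v ?q (2 * j + 1) = ?d j \<cdot>\<^sub>v ?q (2 * j)"
    proof (cases "j = k")
      case True
      then show ?thesis using e Mxz Mz by simp
    next
      case False
      then have "j < k" using j by simp
      then show ?thesis using pair[of j] j by simp
    qed
  qed
  moreover have "\<forall>j\<in>{r..<Suc k}. \<forall>i\<in>{r..j}. ?d i \<le> ?d j"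
    using mono de by (auto simp: less_Suc_eq)
  moreover have "\<forall>j\<in>{r..<Suc k}. \<forall>y \<in> unit_perp N (2 * Suc k) ?q. (?d j)\<^sup>2 \<le> y \<bullet> (M\<^sup>T * M *\<^sub>v y)"
    using low xmin sub e(2) by (auto simp: less_Suc_eq)
  ultimately show ?case using on' by blast
qed

lemma spectral_decomposition:
  assumes "B \<in> carrier_mat N N" "B\<^sup>T = B"
  obtains q c where "orthonormal N N q" "\<And>i. i < N \<Longrightarrow> B *\<^sub>v q i = c i \<cdot>\<^sub>v q i"
    "\<And>i j. j < N \<Longrightarrow> i \<le> j \<Longrightarrow> c i \<le> (c j :: real)"
  using orthonormal_eigenvectors_partial[OF assms order_refl] by blast

section \<open>Matrices with prescribed columns\<close>

definition vecs_mat :: "nat \<Rightarrow> nat \<Rightarrow> (nat \<Rightarrow> real vec) \<Rightarrow> real mat" where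
  "vecs_mat N k q = mat_of_cols N (map q [0..<k])"

lemma vecs_mat_carrier [simp]:
  "vecs_mat N k q \<in> carrier_mat N k" "dim_row (vecs_mat N k q) = N" "dim_col (vecs_mat N k q) = k"
  using mat_of_cols_carrier[of N "map q [0..<k]"] by (auto simp: vecs_mat_def)

lemma col_vecs_mat [simp]:
  "i < k \<Longrightarrow> q i \<in> carrier_vec N \<Longrightarrow> col (vecs_mat N k q) i = q i"
  by (simp add: vecs_mat_def)

lemma orthonormalD:
  assumes "orthonormal N k q"
  shows "i < k \<Longrightarrow> q i \<in> carrier_vec N"
    "i < k \<Longrightarrow> j < k \<Longrightarrow> q i \<bullet> q j = (if i = j then 1 else 0)"
  using assms by (auto simp: orthonormal_def)

lemma mult_mat_unit_vec:
  assumes "A \<in> carrier_mat M N" "i < N"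
  shows "A *\<^sub>v unit_vec N i = col (A :: real mat) i"
  using assms by (intro eq_vecI) auto

lemma vecs_mat_orthonormal:
  assumes "orthonormal N k q"
  shows "(vecs_mat N k q)\<^sup>T * vecs_mat N k q = 1\<^sub>m k"
  by (rule eq_matI) (auto simp: orthonormalD[OF assms])

lemma vecs_mat_orthogonal:
  assumes "orthonormal N N q"
  shows "real_orthogonal_mat N (vecs_mat N N q)"
  unfolding real_orthogonal_mat_def
  using mat_mult_left_right_inverse[OF _ _ vecs_mat_orthonormal[OF assms]] vecs_mat_orthonormal[OF assms]
  by auto

text \<open>The products with the orthogonal matrix of the \<open>q i\<close> agree column by
  column, and that matrix cancels.\<close>

lemma mat_eq_on_orthonormal:
  assumes on: "orthonormal N N q" and A: "A \<in> carrier_mat M N" and B: "B \<in> carrier_mat M N"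
    and eq: "\<And>i. i < N \<Longrightarrow> A *\<^sub>v q i = B *\<^sub>v q i"
  shows "A = B"
proof -
  let ?Q = "vecs_mat N N q"
  have "A * ?Q = B * ?Q"
  proof (rule mat_col_eqI)
    fix i assume "i < dim_col (B * ?Q)"
    then have i: "i < N" by simp
    have "col (A * ?Q) i = A *\<^sub>v q i" "col (B * ?Q) i = B *\<^sub>v q i"
      using col_mult2[OF A vecs_mat_carrier(1) i, of q] col_mult2[OF B vecs_mat_carrier(1) i, of q]
        orthonormalD(1)[OF on i] i by auto
    then show "col (A * ?Q) i = col (B * ?Q) i" using eq[OF i] by simp
  qed (use A B in auto)
  then have "A * (?Q * ?Q\<^sup>T) = B * (?Q * ?Q\<^sup>T)"
    using assoc_mult_mat[of A M N ?Q N "?Q\<^sup>T" N]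
      assoc_mult_mat[of B M N ?Q N "?Q\<^sup>T" N] A B by simp
  then show ?thesis
    using vecs_mat_orthogonal[OF on] A B unfolding real_orthogonal_mat_def by simp
qed

text \<open>The \<open>q i\<close> are the columns of an orthogonal \<open>Q\<close>, so
  \<open>x\<close> is \<open>Q\<close> applied to \<open>Q\<^sup>T *\<^sub>v x\<close>, whose
  entries are the vanishing products.\<close>

lemma orthonormal_complete:
  assumes on: "orthonormal N N q" and x: "x \<in> carrier_vec N" and 0: "\<And>i. i < N \<Longrightarrow> q i \<bullet> x = 0"
  shows "x = 0\<^sub>v N"
proof -
  let ?Q = "vecs_mat N N q"
  have "?Q\<^sup>T *\<^sub>v x = 0\<^sub>v N"
    by (rule eq_vecI) (auto simp: 0 orthonormalD[OF on])
  then have "?Q * ?Q\<^sup>T *\<^sub>v x = 0\<^sub>v N"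
    using x assoc_mult_mat_vec[of ?Q N N "?Q\<^sup>T" N x] by (auto intro!: eq_vecI)
  then show ?thesis
    using vecs_mat_orthogonal[OF on] x unfolding real_orthogonal_mat_def by simp
qed

section \<open>Square roots\<close>

lemma sym_psd_mat_eigenvalue_nonneg:
  assumes "sym_psd_mat N A" "x \<in> carrier_vec N" "x \<bullet> x = 1" "A *\<^sub>v x = c \<cdot>\<^sub>v x"
  shows "0 \<le> c"
proof -
  have "0 \<le> x \<bullet> (A *\<^sub>v x)" using assms(1,2) by (simp add: sym_psd_mat_def)
  then show ?thesis using assms by simp
qed

text \<open>In an orthonormal eigenbasis \<open>Q\<close> the root is
  \<open>Q * diag (sqrt (c i)) * Q\<^sup>T\<close>; the \<open>c i\<close> are nonnegative by
  semidefiniteness. That it squares to \<open>A\<close> is checked on the eigenvectors.\<close>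

lemma sym_psd_mat_sqrt_exists:
  assumes A: "sym_psd_mat N A"
  shows "\<exists>R. sym_psd_mat N R \<and> R * R = A"
proof -
  have Ac: "A \<in> carrier_mat N N" and As: "A\<^sup>T = A" using A by (auto simp: sym_psd_mat_def)
  obtain q c where on: "orthonormal N N q" and eig: "\<And>i. i < N \<Longrightarrow> A *\<^sub>v q i = c i \<cdot>\<^sub>v q i"
    by (rule spectral_decomposition[OF Ac As]) (rule that)
  note qc = orthonormalD(1)[OF on]
  have c0: "0 \<le> c i" if "i < N" for i
    using sym_psd_mat_eigenvalue_nonneg[OF A qc[OF that] _ eig[OF that]] orthonormalD(2)[OF on that that] by simp
  let ?Q = "vecs_mat N N q" and ?D = "mat_diag N (\<lambda>i. sqrt (c i))"
  define R where "R = ?Q * ?D * ?Q\<^sup>T"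
  have R: "R \<in> carrier_mat N N"
    unfolding R_def by (intro mult_carrier_mat[of _ N N]) simp_all
  have DT: "?D\<^sup>T = ?D" by (rule eq_matI) (auto simp: mat_diag_def)
  have RT: "R\<^sup>T = R"
  proof -
    have "R\<^sup>T = (?Q\<^sup>T)\<^sup>T * (?Q * ?D)\<^sup>T"
      unfolding R_def
      by (rule transpose_mult[of _ N N _ N], intro mult_carrier_mat[of _ N N]) simp_all
    also have "(?Q * ?D)\<^sup>T = ?D\<^sup>T * ?Q\<^sup>T" by (rule transpose_mult[of _ N N _ N]) simp_all
    also have "(?Q\<^sup>T)\<^sup>T * (?D\<^sup>T * ?Q\<^sup>T) = ?Q * ?D * ?Q\<^sup>T"
      using assoc_mult_mat[of ?Q N N ?D N "?Q\<^sup>T" N] DT by simp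
    finally show ?thesis by (simp add: R_def)
  qed
  have Dv: "(?D *\<^sub>v v) $ i = sqrt (c i) * v $ i" if "v \<in> carrier_vec N" "i < N" for v i
  proof -
    have "(?D *\<^sub>v v) $ i = (\<Sum>j\<in>{0..<N}. (if i = j then sqrt (c j) else 0) * v $ j)"
      using that by (simp add: mat_diag_def scalar_prod_def)
    also have "\<dots> = (\<Sum>j\<in>{0..<N}. if j = i then sqrt (c i) * v $ i else 0)"
      by (rule sum.cong) auto
    finally show ?thesis using that by simp
  qed
  have Rv: "R *\<^sub>v v = ?Q *\<^sub>v (?D *\<^sub>v (?Q\<^sup>T *\<^sub>v v))" if "v \<in> carrier_vec N" for v
  proof -
    have "R *\<^sub>v v = ?Q * ?D *\<^sub>v (?Q\<^sup>T *\<^sub>v v)"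
      unfolding R_def using that
      by (intro assoc_mult_mat_vec[of _ N N _ N] mult_carrier_mat[of _ N N]) simp_all
    also have "\<dots> = ?Q *\<^sub>v (?D *\<^sub>v (?Q\<^sup>T *\<^sub>v v))"
      using that by (intro assoc_mult_mat_vec[of _ N N _ N] mult_mat_vec_carrier[of _ N N]) simp_all
    finally show ?thesis .
  qed
  have Rq: "R *\<^sub>v q i = sqrt (c i) \<cdot>\<^sub>v q i" if i: "i < N" for i
  proof -
    have "?Q\<^sup>T *\<^sub>v q i = unit_vec N i"
      by (rule eq_vecI) (use i in \<open>auto simp: orthonormalD[OF on] unit_vec_def\<close>)
    then have "R *\<^sub>v q i = ?Q *\<^sub>v (?D *\<^sub>v unit_vec N i)" using Rv[OF qc[OF i]] by simp
    also have "?D *\<^sub>v unit_vec N i = sqrt (c i) \<cdot>\<^sub>v unit_vec N i"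
    proof (rule eq_vecI)
      fix j assume "j < dim_vec (sqrt (c i) \<cdot>\<^sub>v (unit_vec N i :: real vec))"
      then have "j < N" by simp
      then show "(?D *\<^sub>v unit_vec N i) $ j = (sqrt (c i) \<cdot>\<^sub>v unit_vec N i) $ j"
        using Dv[of "unit_vec N i" j] i by (auto simp: unit_vec_def)
    qed (simp add: mat_diag_def)
    also have "?Q *\<^sub>v (sqrt (c i) \<cdot>\<^sub>v unit_vec N i) = sqrt (c i) \<cdot>\<^sub>v (?Q *\<^sub>v unit_vec N i)"
      by (rule mult_mat_vec[of _ N N]) auto
    also have "?Q *\<^sub>v unit_vec N i = q i"
      using mult_mat_unit_vec[of ?Q N N i] i qc[OF i] by simp
    finally show ?thesis .
  qed
  have "0 \<le> x \<bullet> (R *\<^sub>v x)" if x: "x \<in> carrier_vec N" for x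
  proof -
    let ?y = "?Q\<^sup>T *\<^sub>v x"
    have y: "?y \<in> carrier_vec N" using mult_mat_vec_carrier[of "?Q\<^sup>T" N N x] x by simp
    have Dy: "?D *\<^sub>v ?y \<in> carrier_vec N" using mult_mat_vec_carrier[of ?D N N ?y] y by simp
    have "x \<bullet> (R *\<^sub>v x) = ?y \<bullet> (?D *\<^sub>v ?y)"
      unfolding Rv[OF x] using scalar_prod_mult_mat_vec[of ?Q N N x "?D *\<^sub>v ?y"] x Dy by simp
    also have "\<dots> = (\<Sum>i\<in>{0..<N}. ?y $ i * (sqrt (c i) * ?y $ i))"
      unfolding scalar_prod_def[of ?y] using Dy Dv[OF y]
      by (intro sum.cong) (auto simp: carrier_matD(1)[OF mat_diag_dim] simp del: index_mult_mat_vec)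
    also have "0 \<le> \<dots>"
    proof (rule sum_nonneg)
      fix i assume "i \<in> {0..<N}"
      then have "0 \<le> sqrt (c i) * (?y $ i * ?y $ i)" using c0[of i] by auto
      then show "0 \<le> ?y $ i * (sqrt (c i) * ?y $ i)" by (metis mult.left_commute)
    qed
    finally show ?thesis .
  qed
  then have "sym_psd_mat N R" using R RT by (simp add: sym_psd_mat_def)
  moreover have "R * R = A"
  proof (rule mat_eq_on_orthonormal[OF on _ Ac])
    fix i assume i: "i < N"
    have "R * R *\<^sub>v q i = R *\<^sub>v (R *\<^sub>v q i)" using R qc[OF i] by simp
    also have "\<dots> = c i \<cdot>\<^sub>v q i"
      using Rq[OF i] mult_mat_vec[OF R qc[OF i]] c0[OF i] by (simp add: smult_smult_assoc)
    finally show "R * R *\<^sub>v q i = A *\<^sub>v q i" using eig[OF i] by simp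
  qed (use R in simp)
  ultimately show ?thesis by blast
qed

text \<open>By symmetry \<open>|R x|^2\<close> is the scalar product of \<open>x\<close> with
  \<open>R R x\<close>.\<close>

lemma sym_mat_square_kernel:
  assumes R: "R \<in> carrier_mat N N" "R\<^sup>T = R" and x: "x \<in> carrier_vec N"
    and 0: "R * R *\<^sub>v x = 0\<^sub>v N"
  shows "R *\<^sub>v x = (0\<^sub>v N :: real vec)"
proof (rule scalar_prod_self_eq_0)
  have Rx: "R *\<^sub>v x \<in> carrier_vec N" using R x by simp
  then show "R *\<^sub>v x \<in> carrier_vec N" .
  have "(R *\<^sub>v x) \<bullet> (R *\<^sub>v x) = x \<bullet> (R *\<^sub>v (R *\<^sub>v x))"
    using sym_mat_scalar_prod[OF R x Rx] by simp
  then show "(R *\<^sub>v x) \<bullet> (R *\<^sub>v x) = 0" using 0 R x by simp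
qed

text \<open>The vector \<open>v = R x - sqrt c * x\<close> satisfies
  \<open>R v = - sqrt c * v\<close>, because \<open>R^2 - c = (R + sqrt c) (R - sqrt c)\<close>. A
  semidefinite \<open>R\<close> has no negative eigenvalue, so \<open>v = 0\<close>. For
  \<open>c = 0\<close> this gives no information, and the kernel of \<open>R * R\<close> is used
  instead.\<close>

lemma sym_psd_mat_sqrt_eigenvector:
  assumes R: "sym_psd_mat N R" and x: "x \<in> carrier_vec N" and c: "0 \<le> c"
    and eig: "R * R *\<^sub>v x = c \<cdot>\<^sub>v x"
  shows "R *\<^sub>v x = sqrt c \<cdot>\<^sub>v x"
proof (cases "c = 0")
  case True
  have "R * R *\<^sub>v x = 0\<^sub>v N" "sqrt c \<cdot>\<^sub>v x = 0\<^sub>v N"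
    using eig True x by (auto intro!: eq_vecI)
  then show ?thesis
    using sym_mat_square_kernel[of R N x] R x by (simp add: sym_psd_mat_def)
next
  case False
  have Rc: "R \<in> carrier_mat N N" and psd: "\<And>y. y \<in> carrier_vec N \<Longrightarrow> 0 \<le> y \<bullet> (R *\<^sub>v y)"
    using R by (auto simp: sym_psd_mat_def)
  have Rx: "R *\<^sub>v x \<in> carrier_vec N" using Rc x by simp
  define v where "v = R *\<^sub>v x + (- sqrt c) \<cdot>\<^sub>v x"
  have v: "v \<in> carrier_vec N" using Rx x by (simp add: v_def)
  have "R *\<^sub>v v = R *\<^sub>v (R *\<^sub>v x) + (- sqrt c) \<cdot>\<^sub>v (R *\<^sub>v x)"
    unfolding v_def using mult_add_distrib_mat_vec[OF Rc Rx, of "(- sqrt c) \<cdot>\<^sub>v x"] x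
    by (simp add: mult_mat_vec[OF Rc x])
  also have "R *\<^sub>v (R *\<^sub>v x) = c \<cdot>\<^sub>v x" using eig Rc x by simp
  also have "c \<cdot>\<^sub>v x + (- sqrt c) \<cdot>\<^sub>v (R *\<^sub>v x) = (- sqrt c) \<cdot>\<^sub>v v"
  proof -
    have "c \<cdot>\<^sub>v x + (- sqrt c) \<cdot>\<^sub>v u = (- sqrt c) \<cdot>\<^sub>v (u + (- sqrt c) \<cdot>\<^sub>v x)"
      if "u \<in> carrier_vec N" for u
      using that x c by (intro eq_vecI) (auto simp: algebra_simps)
    then show ?thesis using Rx by (simp only: v_def)
  qed
  finally have "0 \<le> - sqrt c * (v \<bullet> v)" using psd[OF v] v by simp
  then have "v \<bullet> v = 0"
    using c False scalar_prod_self_nonneg[of v] by (simp add: mult_le_0_iff)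
  then have v0: "v = 0\<^sub>v N" using scalar_prod_self_eq_0[OF v] by simp
  show ?thesis
  proof (rule eq_vecI)
    fix i assume "i < dim_vec (sqrt c \<cdot>\<^sub>v x)"
    then have i: "i < N" using x by simp
    have "v $ i = (R *\<^sub>v x) $ i - sqrt c * x $ i"
      using i x Rx by (simp add: v_def del: index_mult_mat_vec)
    then show "(R *\<^sub>v x) $ i = (sqrt c \<cdot>\<^sub>v x) $ i" using v0 i x by (simp del: index_mult_mat_vec)
  qed (use Rc x in simp)
qed

text \<open>Every semidefinite root multiplies an eigenvector of \<open>A\<close> for
  \<open>c i\<close> by \<open>sqrt (c i)\<close>, so two roots agree on an orthonormal basis.
  Uniqueness makes the description in \<open>psd_sqrt\<close> denote the root.\<close>

lemma psd_sqrt: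
  assumes A: "sym_psd_mat N A"
  shows "sym_psd_mat N (psd_sqrt A)" "psd_sqrt A * psd_sqrt A = A"
proof -
  have Ac: "A \<in> carrier_mat N N" and As: "A\<^sup>T = A" using A by (auto simp: sym_psd_mat_def)
  obtain q c where on: "orthonormal N N q" and eig: "\<And>i. i < N \<Longrightarrow> A *\<^sub>v q i = c i \<cdot>\<^sub>v q i"
    by (rule spectral_decomposition[OF Ac As]) (rule that)
  note qc = orthonormalD(1)[OF on]
  have c0: "0 \<le> c i" if "i < N" for i
    using sym_psd_mat_eigenvalue_nonneg[OF A qc[OF that] _ eig[OF that]] orthonormalD(2)[OF on that that] by simp
  have uniq: "R = R'" if "sym_psd_mat N R" "R * R = A" "sym_psd_mat N R'" "R' * R' = A" for R R'
  proof (rule mat_eq_on_orthonormal[OF on])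
    fix i assume i: "i < N"
    show "R *\<^sub>v q i = R' *\<^sub>v q i"
      using sym_psd_mat_sqrt_eigenvector[OF that(1) qc[OF i] c0[OF i]]
        sym_psd_mat_sqrt_eigenvector[OF that(3) qc[OF i] c0[OF i]] that eig[OF i] by simp
  qed (use that in \<open>auto simp: sym_psd_mat_def\<close>)
  have "\<exists>!R. sym_psd_mat N R \<and> R * R = A"
    using sym_psd_mat_sqrt_exists[OF A] uniq by blast
  from theI'[OF this] show "sym_psd_mat N (psd_sqrt A)" "psd_sqrt A * psd_sqrt A = A"
    using Ac by (auto simp: psd_sqrt_def)
qed

section \<open>Bases of the kernel\<close>

text \<open>Equal columns \<open>i\<close> and \<open>j\<close> of \<open>B\<close> would make the
  entries \<open>(i, i)\<close> and \<open>(i, j)\<close> of \<open>C * B\<close> equal.\<close>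

lemma left_inverse_imp_distinct_cols:
  assumes B: "B \<in> carrier_mat N r" and C: "C \<in> carrier_mat r N" and CB: "C * B = (1\<^sub>m r :: real mat)"
  shows "distinct (cols B)"
  unfolding distinct_conv_nth
proof (intro allI impI notI)
  fix i j assume i: "i < length (cols B)" and j: "j < length (cols B)" and ij: "i \<noteq> j"
    and eq: "cols B ! i = cols B ! j"
  have r: "i < r" "j < r" using i j B by auto
  have "col B i = col B j" using eq r B by simp
  then have "(C * B) $$ (i, i) = (C * B) $$ (i, j)" using r B C by simp
  then show False using CB r ij by simp
qed

text \<open>A relation \<open>B *\<^sub>v v = 0\<close> gives
  \<open>v = C *\<^sub>v (B *\<^sub>v v) = 0\<close>; dependence inside the kernel is the same as
  dependence in the ambient space.\<close>

lemma (in kernel) left_inverse_imp_lin_indpt_cols: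
  fixes B C :: "'a mat"
  assumes B: "B \<in> carrier_mat nc r" and C: "C \<in> carrier_mat r nc" and CB: "C * B = 1\<^sub>m r"
    and dist: "distinct (cols B)" and sub: "set (cols B) \<subseteq> mat_kernel A"
  shows "\<not> lin_dep (set (cols B))"
proof
  assume "lin_dep (set (cols B))"
  then have "NC.lin_dep (set (cols B))" using lindep_same[OF sub] by simp
  then obtain v where v: "v \<in> carrier_vec r" "v \<noteq> 0\<^sub>v r" "B *\<^sub>v v = 0\<^sub>v nc"
    using NC.lin_depE[OF B _ dist] by blast
  have "v = C *\<^sub>v (B *\<^sub>v v)" using assoc_mult_mat_vec[OF C B v(1)] CB v(1) by simp
  also have "\<dots> = 0\<^sub>v r" using v(3) C by (auto intro!: eq_vecI)
  finally show False using v(2) by simp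
qed

text \<open>Independent vectors of the kernel, at least as many as its dimension, form a
  basis.\<close>

lemma (in kernel) basis_of_left_inverse:
  fixes B C :: "'a mat"
  assumes B: "B \<in> carrier_mat nc r" and C: "C \<in> carrier_mat r nc" and CB: "C * B = 1\<^sub>m r"
    and dist: "distinct (cols B)" and sub: "set (cols B) \<subseteq> mat_kernel A" and r: "dim \<le> r"
  shows "basis (set (cols B))"
proof (rule Ker.dim_li_is_basis)
  obtain X where "finite X" "basis X" using kernel_basis_exists[OF A] by blast
  then show "Ker.fin_dim" by (auto simp: Ker.fin_dim_def Ker.basis_def)
  show "dim \<le> card (set (cols B))" using distinct_card[OF dist] B r by simp
qed (use sub left_inverse_imp_lin_indpt_cols[OF B C CB dist sub] in auto)

text \<open>By \<open>range\<close> the columns span the kernel; being independent and distinct,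
  they are a basis with \<open>r\<close> elements.\<close>

lemma (in kernel) dim_of_left_inverse:
  fixes B C :: "'a mat"
  assumes B: "B \<in> carrier_mat nc r" and C: "C \<in> carrier_mat r nc" and CB: "C * B = 1\<^sub>m r"
    and dist: "distinct (cols B)" and sub: "set (cols B) \<subseteq> mat_kernel A"
    and range: "\<And>x. x \<in> mat_kernel A \<Longrightarrow> \<exists>t \<in> carrier_vec r. x = B *\<^sub>v t"
  shows "dim = r"
proof -
  have "mat_kernel A \<subseteq> NC.span (set (cols B))"
  proof
    fix x assume x: "x \<in> mat_kernel A"
    then obtain t where "t \<in> carrier_vec r" "x = B *\<^sub>v t" using range by blast
    then have "x \<in> NC.col_space B"
      unfolding NC.col_space_eq[OF B] using B by auto
    then show "x \<in> NC.span (set (cols B))" by (simp add: NC.col_space_def)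
  qed
  then have "mat_kernel A = span (set (cols B))"
    using span_same[OF sub] Ker.span_is_subset2[OF sub] by auto
  then have "basis (set (cols B))"
    unfolding Ker.basis_def using left_inverse_imp_lin_indpt_cols[OF B C CB dist sub] sub by auto
  then show ?thesis using Ker.dim_basis[of "set (cols B)"] distinct_card[OF dist] B by simp
qed

text \<open>The eigenvalues are nonnegative and sorted, so the zero ones come first and their
  eigenvectors form an orthonormal basis of the kernel. The last two conclusions supply injectivity
  on the complement and coordinates within the kernel.\<close>

lemma orthonormal_kernel_exists:
  assumes A: "sym_psd_mat N A"
  obtains q where "orthonormal N (kernel.dim N A) q"
    "\<And>i. i < kernel.dim N A \<Longrightarrow> A *\<^sub>v q i = 0\<^sub>v N"
    "\<And>x. x \<in> unit_perp N (kernel.dim N A) q \<Longrightarrow> A *\<^sub>v x \<noteq> 0\<^sub>v N"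
    "\<And>x. x \<in> mat_kernel A \<Longrightarrow>
      \<exists>t \<in> carrier_vec (kernel.dim N A). x = vecs_mat N (kernel.dim N A) q *\<^sub>v t"
proof -
  have Ac: "A \<in> carrier_mat N N" and As: "A\<^sup>T = A" using A by (auto simp: sym_psd_mat_def)
  obtain q c where on: "orthonormal N N q" and eig: "\<And>i. i < N \<Longrightarrow> A *\<^sub>v q i = c i \<cdot>\<^sub>v q i"
    and mono: "\<And>i j. j < N \<Longrightarrow> i \<le> j \<Longrightarrow> c i \<le> (c j :: real)"
    by (rule spectral_decomposition[OF Ac As]) (rule that)
  note qc = orthonormalD(1)[OF on]
  have c0: "0 \<le> c i" if "i < N" for i
    using sym_psd_mat_eigenvalue_nonneg[OF A qc[OF that] _ eig[OF that]] orthonormalD(2)[OF on that that] by simp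
  \<comment> \<open>The number of zero eigenvalues: the first index with a nonzero one, or
    \<open>N\<close> if all vanish.\<close>
  define r where "r = (LEAST r. r = N \<or> c r \<noteq> 0)"
  have r: "r = N \<or> c r \<noteq> 0" unfolding r_def by (rule LeastI[of _ N]) simp
  have rN: "r \<le> N" unfolding r_def by (rule Least_le) simp
  have zero: "c i = 0" if "i < r" for i
    using not_less_Least[of i "\<lambda>r. r = N \<or> c r \<noteq> 0"] that by (simp flip: r_def)
  have pos: "c i \<noteq> 0" if "r \<le> i" "i < N" for i
    using mono[of i r] r that c0[of r] by force
  have onr: "orthonormal N r q" using on rN by (simp add: orthonormal_def)
  have Aq: "A *\<^sub>v q i = 0\<^sub>v N" if "i < r" for i
    using eig[of i] zero[OF that] that rN qc[of i] by (auto intro!: eq_vecI)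
  \<comment> \<open>Symmetry makes a kernel vector orthogonal to eigenvectors with nonzero
    eigenvalue.\<close>
  have perp: "q i \<bullet> x = 0" if x: "x \<in> carrier_vec N" "A *\<^sub>v x = 0\<^sub>v N" and i: "r \<le> i" "i < N" for x i
  proof -
    have "x \<bullet> (A *\<^sub>v q i) = q i \<bullet> (A *\<^sub>v x)" by (rule sym_mat_scalar_prod[OF Ac As x(1) qc[OF i(2)]])
    then have "c i * (x \<bullet> q i) = 0" using eig[OF i(2)] x qc[OF i(2)] by simp
    then show ?thesis using pos[OF i] comm_scalar_prod[OF x(1) qc[OF i(2)]] by simp
  qed
  have inj: "A *\<^sub>v x \<noteq> 0\<^sub>v N" if x: "x \<in> unit_perp N r q" for x
  proof
    assume 0: "A *\<^sub>v x = 0\<^sub>v N"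
    have xc: "x \<in> carrier_vec N" and xx: "x \<bullet> x = 1" and xq: "\<And>i. i < r \<Longrightarrow> q i \<bullet> x = 0"
      using x by (auto simp: unit_perp_def)
    have "x = 0\<^sub>v N"
      using orthonormal_complete[OF on xc] perp[OF xc 0] xq by (meson not_le)
    then show False using xx by simp
  qed
  interpret kernel N N A by unfold_locales (rule Ac)
  let ?B = "vecs_mat N r q"
  have BB: "?B\<^sup>T * ?B = 1\<^sub>m r" by (rule vecs_mat_orthonormal[OF onr])
  have range: "\<exists>t \<in> carrier_vec r. x = ?B *\<^sub>v t" if "x \<in> mat_kernel A" for x
  proof -
    have x: "x \<in> carrier_vec N" "A *\<^sub>v x = 0\<^sub>v N" using mat_kernelD[OF Ac that] by auto
    \<comment> \<open>With this \<open>t\<close>, \<open>?B *\<^sub>v t\<close> is the orthogonal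
      projection of \<open>x\<close> onto the first \<open>r\<close> vectors. The residual is
      orthogonal to these, and to the others because of \<open>perp\<close>.\<close>
    define t where "t = ?B\<^sup>T *\<^sub>v x"
    have t: "t \<in> carrier_vec r" using mult_mat_vec_carrier[of "?B\<^sup>T" r N x] x by (simp add: t_def)
    have Bt: "?B *\<^sub>v t \<in> carrier_vec N" using mult_mat_vec_carrier[of ?B N r t] t by simp
    have BTq: "(?B\<^sup>T *\<^sub>v q i) \<bullet> t = (if i < r then q i \<bullet> x else 0)" if i: "i < N" for i
    proof -
      have "?B\<^sup>T *\<^sub>v q i = (if i < r then unit_vec r i else 0\<^sub>v r)"
        by (rule eq_vecI) (use i rN in \<open>auto simp: orthonormalD[OF on] unit_vec_def\<close>)
      then show ?thesis using t qc[OF i] by (auto simp: t_def)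
    qed
    have eq0: "x - ?B *\<^sub>v t = 0\<^sub>v N"
    proof (rule orthonormal_complete[OF on])
      fix i assume i: "i < N"
      have "q i \<bullet> (x - ?B *\<^sub>v t) = q i \<bullet> x - q i \<bullet> (?B *\<^sub>v t)"
        by (rule scalar_prod_minus_distrib[OF qc[OF i] x(1) Bt])
      also have "q i \<bullet> (?B *\<^sub>v t) = (?B\<^sup>T *\<^sub>v q i) \<bullet> t"
        by (rule scalar_prod_mult_mat_vec[OF _ qc[OF i] t]) simp
      finally show "q i \<bullet> (x - ?B *\<^sub>v t) = 0"
        using BTq[OF i] perp[OF x, of i] i by (auto simp: not_less)
    qed (use x Bt in simp)
    have "x = ?B *\<^sub>v t"
    proof (rule eq_vecI)
      fix i assume "i < dim_vec (?B *\<^sub>v t)"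
      then have i: "i < N" by simp
      have "(x - ?B *\<^sub>v t) $ i = x $ i - (?B *\<^sub>v t) $ i" using i x Bt by simp
      then show "x $ i = (?B *\<^sub>v t) $ i" using eq0 i by simp
    qed (use x in simp)
    then show ?thesis using t by blast
  qed
  have "kernel.dim N A = r"
  proof (rule dim_of_left_inverse[of ?B r "?B\<^sup>T"])
    show "distinct (cols ?B)" using left_inverse_imp_distinct_cols[of ?B N r "?B\<^sup>T"] BB by simp
    show "set (cols ?B) \<subseteq> mat_kernel A"
    proof
      fix x assume "x \<in> set (cols ?B)"
      then obtain i where "i < r" "x = q i"
        using orthonormalD(1)[OF onr] by (auto simp: cols_def)
      then show "x \<in> mat_kernel A" using Aq orthonormalD(1)[OF onr] by (auto intro!: mat_kernelI[OF Ac])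
    qed
  qed (use BB range in auto)
  then show thesis using that[of q] onr Aq inj range by simp
qed

section \<open>Symplectic block matrices\<close>

text \<open>Reduces matrix identities of the shape \<open>U\<^sup>T * B * V\<close> to scalar
  products of columns, the form in which the normal forms below are verified.\<close>

lemma vecs_mat_form_index:
  assumes B: "B \<in> carrier_mat N N" and i: "i < k" "u i \<in> carrier_vec N" and j: "j < l" "v j \<in> carrier_vec N"
  shows "((vecs_mat N k u)\<^sup>T * B * vecs_mat N l v) $$ (i, j) = u i \<bullet> (B *\<^sub>v v j)"
proof -
  have "(vecs_mat N k u)\<^sup>T * B * vecs_mat N l v = (vecs_mat N k u)\<^sup>T * (B * vecs_mat N l v)"
    by (rule assoc_mult_mat[of _ k N _ N _ l]) (use B in simp_all)
  moreover have "col (B * vecs_mat N l v) j = B *\<^sub>v v j"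
    using col_mult2[OF B vecs_mat_carrier(1) j(1), of v] j by simp
  ultimately show ?thesis using i j B by simp
qed

lemma vecs_mat_col:
  assumes "Q \<in> carrier_mat N k"
  shows "vecs_mat N k (col Q) = Q"
  by (rule mat_col_eqI) (use assms in auto)

section \<open>The matrix of the standard symplectic form\<close>

lemma J_mat_carrier [simp]: "J_mat n \<in> carrier_mat (2 * n) (2 * n)"
  unfolding J_mat_def using four_block_carrier_mat[of "0\<^sub>m n n" n n "0\<^sub>m n n" n n "1\<^sub>m n" "- 1\<^sub>m n"]
  by (simp add: mult_2)

lemma J_mat_index:
  assumes "i < 2 * n" "j < 2 * n"
  shows "J_mat n $$ (i, j) = (if i < n \<and> j = n + i then 1 else if j < n \<and> i = n + j then - 1 else 0)"
  using assms unfolding J_mat_def by (subst index_mat_four_block) auto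

lemma J_mat_transpose: "(J_mat n)\<^sup>T = - J_mat n"
  by (rule eq_matI) (auto simp: J_mat_index carrier_matD[OF J_mat_carrier])

lemma J_mat_square: "J_mat n * J_mat n = - 1\<^sub>m (2 * n)"
proof -
  have "J_mat n * J_mat n = four_block_mat (- 1\<^sub>m n) (0\<^sub>m n n) (0\<^sub>m n n) (- 1\<^sub>m n)"
    unfolding J_mat_def
    by (subst mult_four_block_mat[of _ n n _ n _ n _ _ n _ n]) auto
  also have "\<dots> = - 1\<^sub>m (2 * n)"
    by (rule eq_matI) (auto simp: index_mat_four_block)
  finally show ?thesis .
qed

lemma J_mat_vec_carrier [simp]: "x \<in> carrier_vec (2 * n) \<Longrightarrow> J_mat n *\<^sub>v x \<in> carrier_vec (2 * n)"
  by (rule mult_mat_vec_carrier[OF J_mat_carrier])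

lemma J_mat_vec_square:
  assumes "x \<in> carrier_vec (2 * n)"
  shows "J_mat n *\<^sub>v (J_mat n *\<^sub>v x) = - x"
proof -
  have "J_mat n *\<^sub>v (J_mat n *\<^sub>v x) = J_mat n * J_mat n *\<^sub>v x"
    by (rule assoc_mult_mat_vec[symmetric, OF J_mat_carrier J_mat_carrier assms])
  also have "\<dots> = - x" unfolding J_mat_square using assms by (simp add: uminus_mult_mat_vec)
  finally show ?thesis .
qed

lemma skew_mat_scalar_prod:
  assumes M: "M \<in> carrier_mat N N" "M\<^sup>T = - M" and u: "u \<in> carrier_vec N" and v: "v \<in> carrier_vec N"
  shows "u \<bullet> (M *\<^sub>v v) = - ((M *\<^sub>v u) \<bullet> (v :: real vec))"
    and "u \<bullet> (M *\<^sub>v v) = - (v \<bullet> (M *\<^sub>v u))"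
proof -
  have "u \<bullet> (M *\<^sub>v v) = (- M *\<^sub>v u) \<bullet> v"
    using scalar_prod_mult_mat_vec[OF M(1) u v] M(2) by simp
  also have "- M *\<^sub>v u = - (M *\<^sub>v u)" using M u by (intro uminus_mult_mat_vec) auto
  finally show *: "u \<bullet> (M *\<^sub>v v) = - ((M *\<^sub>v u) \<bullet> v)" using M u v by simp
  show "u \<bullet> (M *\<^sub>v v) = - (v \<bullet> (M *\<^sub>v u))"
    using * comm_scalar_prod[OF v, of "M *\<^sub>v u"] M u by simp
qed

lemmas J_mat_scalar_prod = skew_mat_scalar_prod[OF J_mat_carrier J_mat_transpose]

section \<open>Block identities read off families of columns\<close>

definition join_vecs :: "nat \<Rightarrow> (nat \<Rightarrow> real vec) \<Rightarrow> (nat \<Rightarrow> real vec) \<Rightarrow> nat \<Rightarrow> real vec" where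
  "join_vecs k a b j = (if j < k then a j else b (j - k))"

text \<open>Kept as an equivalence since both directions serve: the identity for a given
  \<open>W\<close> is turned into relations between its columns, and relations between constructed
  columns into matrix identities.\<close>

lemma vecs_mat_form_eq_four_block:
  assumes B: "B \<in> carrier_mat N N"
    and ab: "\<And>i. i < k \<Longrightarrow> a i \<in> carrier_vec N" "\<And>i. i < k \<Longrightarrow> b i \<in> carrier_vec N"
    and P: "P \<in> carrier_mat k k" "Q \<in> carrier_mat k k" "R \<in> carrier_mat k k" "S \<in> carrier_mat k k"
  shows "(vecs_mat N (2 * k) (join_vecs k a b))\<^sup>T * B * vecs_mat N (2 * k) (join_vecs k a b) =
      four_block_mat P Q R S \<longleftrightarrow>
    (\<forall>i<k. \<forall>j<k. a i \<bullet> (B *\<^sub>v a j) = P $$ (i, j) \<and> a i \<bullet> (B *\<^sub>v b j) = Q $$ (i, j) \<and>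
       b i \<bullet> (B *\<^sub>v a j) = R $$ (i, j) \<and> b i \<bullet> (B *\<^sub>v b j) = S $$ (i, j))"
  (is "?F = ?G \<longleftrightarrow> ?rhs")
proof -
  let ?s = "join_vecs k a b"
  have s: "?s i \<in> carrier_vec N" if "i < 2 * k" for i
    using ab that by (auto simp: join_vecs_def)
  have F: "?F $$ (i, j) = ?s i \<bullet> (B *\<^sub>v ?s j)" if "i < 2 * k" "j < 2 * k" for i j
    using vecs_mat_form_index[OF B, of i "2 * k" ?s j "2 * k" ?s] s that by simp
  have G: "?G $$ (i, j) = (if i < k then if j < k then P $$ (i, j) else Q $$ (i, j - k)
      else if j < k then R $$ (i - k, j) else S $$ (i - k, j - k))" if "i < 2 * k" "j < 2 * k" for i j
    using that P by (subst index_mat_four_block) auto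
  have Fc: "?F \<in> carrier_mat (2 * k) (2 * k)" and Gc: "?G \<in> carrier_mat (2 * k) (2 * k)"
    using four_block_carrier_mat[OF P(1,4)] B by (auto simp: mult_2)
  show ?thesis
  proof
    assume eq: "?F = ?G"
    show ?rhs
    proof (intro allI impI)
      fix i j assume ij: "i < k" "j < k"
      have "?s i = a i" "?s j = a j" "?s (k + i) = b i" "?s (k + j) = b j"
        using ij by (auto simp: join_vecs_def)
      moreover have "i < 2 * k" "j < 2 * k" "k + i < 2 * k" "k + j < 2 * k" using ij by auto
      ultimately show "a i \<bullet> (B *\<^sub>v a j) = P $$ (i, j) \<and> a i \<bullet> (B *\<^sub>v b j) = Q $$ (i, j) \<and>
        b i \<bullet> (B *\<^sub>v a j) = R $$ (i, j) \<and> b i \<bullet> (B *\<^sub>v b j) = S $$ (i, j)"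
        using F[of i j] F[of i "k + j"] F[of "k + i" j] F[of "k + i" "k + j"]
          G[of i j] G[of i "k + j"] G[of "k + i" j] G[of "k + i" "k + j"] eq ij by simp
    qed
  next
    assume ?rhs
    show "?F = ?G"
    proof (rule eq_matI)
      fix i j assume "i < dim_row ?G" "j < dim_col ?G"
      then have ij: "i < 2 * k" "j < 2 * k" using Gc by (auto simp del: index_mat_four_block)
      show "?F $$ (i, j) = ?G $$ (i, j)"
        unfolding F[OF ij] G[OF ij] using \<open>?rhs\<close> ij by (auto simp: join_vecs_def)
    qed (use Fc Gc in \<open>auto simp del: index_mat_four_block\<close>)
  qed
qed

lemma vecs_mat_J_form:
  assumes "\<And>i. i < m \<Longrightarrow> a i \<in> carrier_vec (2 * n)" "\<And>i. i < m \<Longrightarrow> b i \<in> carrier_vec (2 * n)"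
  shows "(vecs_mat (2 * n) (2 * m) (join_vecs m a b))\<^sup>T * J_mat n * vecs_mat (2 * n) (2 * m) (join_vecs m a b)
      = J_mat m \<longleftrightarrow>
    (\<forall>i<m. \<forall>j<m. a i \<bullet> (J_mat n *\<^sub>v a j) = 0 \<and> a i \<bullet> (J_mat n *\<^sub>v b j) = (if i = j then 1 else 0) \<and>
       b i \<bullet> (J_mat n *\<^sub>v a j) = (if i = j then - 1 else 0) \<and> b i \<bullet> (J_mat n *\<^sub>v b j) = 0)"
  unfolding J_mat_def[of m] by (subst vecs_mat_form_eq_four_block[OF J_mat_carrier assms]) auto

lemma append_cols_vecs_mat:
  assumes "\<And>i. i < k \<Longrightarrow> u i \<in> carrier_vec N" "\<And>i. i < l \<Longrightarrow> v i \<in> carrier_vec N"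
  shows "vecs_mat N k u @\<^sub>c vecs_mat N l v = vecs_mat N (k + l) (join_vecs k u v)"
proof -
  have "cols (vecs_mat N k u) = map u [0..<k]" "cols (vecs_mat N l v) = map v [0..<l]"
    unfolding vecs_mat_def using assms by (auto intro!: cols_mat_of_cols)
  moreover have "map u [0..<k] @ map v [0..<l] = map (join_vecs k u v) [0..<k + l]"
    by (rule nth_equalityI) (auto simp: nth_append join_vecs_def)
  ultimately show ?thesis unfolding append_cols_def by (simp add: vecs_mat_def)
qed

text \<open>Induction over the list: passing the head block lowers both indices by 2, which lowers
  \<open>i div 2\<close> by one and keeps \<open>i mod 2\<close>. The dimension is proved along with
  the entries because the step needs it to locate the blocks.\<close>

lemma diag_block_mat_2x2:
  assumes "\<forall>B \<in> set Bs. B \<in> carrier_mat 2 2"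
  shows "diag_block_mat Bs \<in> carrier_mat (2 * length Bs) (2 * length Bs) \<and>
    (\<forall>i < 2 * length Bs. \<forall>j < 2 * length Bs. diag_block_mat Bs $$ (i, j) =
      (if i div 2 = j div 2 then (Bs ! (i div 2)) $$ (i mod 2, j mod 2) else 0))"
  using assms
proof (induction Bs)
  case Nil
  then show ?case by simp
next
  case (Cons B Bs)
  let ?D = "diag_block_mat Bs" and ?k = "2 * length Bs"
  have B: "B \<in> carrier_mat 2 2" and D: "?D \<in> carrier_mat ?k ?k"
    and Di: "\<And>i j. i < ?k \<Longrightarrow> j < ?k \<Longrightarrow>
      ?D $$ (i, j) = (if i div 2 = j div 2 then (Bs ! (i div 2)) $$ (i mod 2, j mod 2) else 0)"
    using Cons by auto
  have eq: "diag_block_mat (B # Bs) = four_block_mat B (0\<^sub>m 2 ?k) (0\<^sub>m ?k 2) ?D"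
    using B D by (simp add: Let_def)
  have "diag_block_mat (B # Bs) $$ (i, j) =
      (if i div 2 = j div 2 then ((B # Bs) ! (i div 2)) $$ (i mod 2, j mod 2) else 0)"
    if ij: "i < 2 * length (B # Bs)" "j < 2 * length (B # Bs)" for i j
  proof -
    have e: "diag_block_mat (B # Bs) $$ (i, j) = (if i < 2 then if j < 2 then B $$ (i, j) else 0
        else if j < 2 then 0 else ?D $$ (i - 2, j - 2))"
      unfolding eq using ij B D by (subst index_mat_four_block) auto
    consider "i < 2" "j < 2" | "i < 2" "2 \<le> j" | "2 \<le> i" "j < 2" | "2 \<le> i" "2 \<le> j" by linarith
    then show ?thesis
    proof cases
      case 4
      define i' j' where "i' = i - 2" and "j' = j - 2"
      have "i = i' + 2" "j = j' + 2" using 4 by (auto simp: i'_def j'_def)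
      then show ?thesis using e Di[of i' j'] ij by auto
    qed (use e in auto)
  qed
  moreover have "diag_block_mat (B # Bs) \<in> carrier_mat (2 * length (B # Bs)) (2 * length (B # Bs))"
    unfolding eq using four_block_carrier_mat[OF B D] by simp
  ultimately show ?case by blast
qed

text \<open>Entry \<open>(i, j)\<close> of the block-diagonal normal form. Blocks are counted from 0
  by \<open>i div 2\<close> but the values of \<open>d\<close> from 1, hence the
  \<open>+ 1\<close>.\<close>

definition skew_entry :: "nat \<Rightarrow> (nat \<Rightarrow> real) \<Rightarrow> nat \<Rightarrow> nat \<Rightarrow> real" where
  "skew_entry m d i j = (if i div 2 = j div 2 \<and> m \<le> i div 2 then
     (if even i \<and> odd j then d (i div 2 + 1) else if odd i \<and> even j then - d (i div 2 + 1) else 0) else 0)"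

lemma skew_diag_index:
  fixes d :: "nat \<Rightarrow> real" and n m :: nat
  defines "L \<equiv> diag_block_mat (replicate m (0\<^sub>m 2 2) @ map (\<lambda>i. skew_block (d i)) [m + 1..<n + 1])"
  assumes mn: "m \<le> n"
  shows "L \<in> carrier_mat (2 * n) (2 * n)"
    and "i < 2 * n \<Longrightarrow> j < 2 * n \<Longrightarrow> L $$ (i, j) = skew_entry m d i j"
proof -
  let ?Bs = "replicate m (0\<^sub>m 2 2) @ map (\<lambda>i. skew_block (d i)) [m + 1..<n + 1]"
  have sk: "skew_block x \<in> carrier_mat 2 2" for x
    unfolding skew_block_def by (rule carrier_matI) (simp_all add: mat_of_rows_list_def)
  have all: "\<forall>B \<in> set ?Bs. B \<in> carrier_mat 2 2" using sk by auto
  have len: "length ?Bs = n" using mn by simp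
  note D = diag_block_mat_2x2[OF all, unfolded len]
  show "L \<in> carrier_mat (2 * n) (2 * n)" using D by (simp add: L_def)
  assume ij: "i < 2 * n" "j < 2 * n"
  have "?Bs ! (i div 2) = (if i div 2 < m then 0\<^sub>m 2 2 else skew_block (d (i div 2 + 1)))"
    using ij by (auto simp: nth_append simp del: upt_Suc)
  moreover have "skew_block x $$ (i mod 2, j mod 2) =
      (if even i \<and> odd j then x else if odd i \<and> even j then - x else 0)" for x
    unfolding skew_block_def mat_of_rows_list_def
    by (cases "even i"; cases "even j") (auto simp: even_iff_mod_2_eq_zero odd_iff_mod_2_eq_one)
  ultimately show "L $$ (i, j) = skew_entry m d i j"
    using D ij unfolding L_def skew_entry_def by auto
qed

section \<open>The skew-symmetric matrix \<open>R J R\<close>\<close>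

lemma mult_mat_zero_vec:
  assumes "B \<in> carrier_mat k l"
  shows "B *\<^sub>v 0\<^sub>v l = (0\<^sub>v k :: real vec)"
  using assms by (intro eq_vecI) auto

lemma psd_sqrt_carrier:
  assumes "sym_psd_mat N A"
  shows "psd_sqrt A \<in> carrier_mat N N" "(psd_sqrt A)\<^sup>T = psd_sqrt A"
  using psd_sqrt(1)[OF assms] by (auto simp: sym_psd_mat_def)

lemma psd_sqrt_mult_vec:
  assumes A: "sym_psd_mat N A" and x: "x \<in> carrier_vec N"
  shows "psd_sqrt A *\<^sub>v (psd_sqrt A *\<^sub>v x) = A *\<^sub>v x"
  using psd_sqrt(2)[OF A] assoc_mult_mat_vec[OF psd_sqrt_carrier(1)[OF A] psd_sqrt_carrier(1)[OF A] x]
  by simp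

lemma psd_sqrt_kernel:
  assumes A: "sym_psd_mat N A" and x: "x \<in> carrier_vec N"
  shows "psd_sqrt A *\<^sub>v x = 0\<^sub>v N \<longleftrightarrow> A *\<^sub>v x = 0\<^sub>v N"
proof
  assume 0: "psd_sqrt A *\<^sub>v x = 0\<^sub>v N"
  show "A *\<^sub>v x = 0\<^sub>v N"
    using psd_sqrt_mult_vec[OF A x] mult_mat_zero_vec[OF psd_sqrt_carrier(1)[OF A]] unfolding 0 by simp
next
  assume "A *\<^sub>v x = 0\<^sub>v N"
  then show "psd_sqrt A *\<^sub>v x = 0\<^sub>v N"
    using sym_mat_square_kernel[OF psd_sqrt_carrier[OF A] x] psd_sqrt(2)[OF A] by simp
qed

definition skew_of :: "nat \<Rightarrow> real mat \<Rightarrow> real mat" where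
  "skew_of n A = psd_sqrt A * J_mat n * psd_sqrt A"

lemma skew_of_carrier:
  assumes A: "sym_psd_mat (2 * n) A"
  shows "skew_of n A \<in> carrier_mat (2 * n) (2 * n)" "(skew_of n A)\<^sup>T = - skew_of n A"
    and "x \<in> carrier_vec (2 * n) \<Longrightarrow> skew_of n A *\<^sub>v x = psd_sqrt A *\<^sub>v (J_mat n *\<^sub>v (psd_sqrt A *\<^sub>v x))"
proof -
  let ?R = "psd_sqrt A" and ?J = "J_mat n"
  note R = psd_sqrt_carrier[OF A]
  have RJ: "?R * ?J \<in> carrier_mat (2 * n) (2 * n)" by (rule mult_carrier_mat[OF R(1) J_mat_carrier])
  show "skew_of n A \<in> carrier_mat (2 * n) (2 * n)"
    unfolding skew_of_def by (rule mult_carrier_mat[OF RJ R(1)])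
  have "(skew_of n A)\<^sup>T = ?R * (?R * ?J)\<^sup>T"
    unfolding skew_of_def using transpose_mult[OF RJ R(1)] R(2) by simp
  also have "(?R * ?J)\<^sup>T = (- ?J) * ?R"
    using transpose_mult[OF R(1) J_mat_carrier] R(2) by (simp add: J_mat_transpose)
  also have "\<dots> = - (?J * ?R)" using R(1) carrier_matD[OF J_mat_carrier, of n] by simp
  also have "?R * - (?J * ?R) = - (?R * (?J * ?R))"
    using R(1) carrier_matD[OF J_mat_carrier, of n] by simp
  also have "?R * (?J * ?R) = skew_of n A"
    unfolding skew_of_def by (rule assoc_mult_mat[symmetric, OF R(1) J_mat_carrier R(1)])
  finally show "(skew_of n A)\<^sup>T = - skew_of n A" .
  assume x: "x \<in> carrier_vec (2 * n)"
  have Rx: "?R *\<^sub>v x \<in> carrier_vec (2 * n)" using R(1) x by simp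
  show "skew_of n A *\<^sub>v x = ?R *\<^sub>v (?J *\<^sub>v (?R *\<^sub>v x))"
    unfolding skew_of_def assoc_mult_mat_vec[OF RJ R(1) x]
    by (rule assoc_mult_mat_vec[OF R(1) J_mat_carrier Rx])
qed

text \<open>Put \<open>y = J R x\<close>, which \<open>R\<close> annihilates, so \<open>y\<close>
  lies in the kernel of \<open>A\<close>. For \<open>z\<close> in that kernel,
  \<open>y . J z = z . R x = x . R z = 0\<close>, so the symplectic kernel forces
  \<open>y = 0\<close>; applying \<open>J\<close> once more gives \<open>R x = 0\<close>.\<close>

lemma skew_of_kernel:
  assumes A: "sym_psd_mat (2 * n) A" and K: "symplectic_subspace n (mat_kernel A)"
    and x: "x \<in> carrier_vec (2 * n)" and 0: "skew_of n A *\<^sub>v x = 0\<^sub>v (2 * n)"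
  shows "A *\<^sub>v x = 0\<^sub>v (2 * n)"
proof -
  let ?R = "psd_sqrt A" and ?J = "J_mat n"
  note R = psd_sqrt_carrier[OF A]
  have Ac: "A \<in> carrier_mat (2 * n) (2 * n)" using A by (simp add: sym_psd_mat_def)
  have Rx: "?R *\<^sub>v x \<in> carrier_vec (2 * n)" using R(1) x by simp
  define y where "y = ?J *\<^sub>v (?R *\<^sub>v x)"
  have y: "y \<in> carrier_vec (2 * n)" using Rx by (simp add: y_def)
  have "?R *\<^sub>v y = 0\<^sub>v (2 * n)" using 0 skew_of_carrier(3)[OF A x] by (simp add: y_def)
  then have yK: "y \<in> mat_kernel A" using psd_sqrt_kernel[OF A y] y by (intro mat_kernelI[OF Ac]) auto
  have "y = 0\<^sub>v (2 * n)"
  proof (rule ccontr)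
    assume "y \<noteq> 0\<^sub>v (2 * n)"
    then obtain z where z: "z \<in> mat_kernel A" "y \<bullet> (?J *\<^sub>v z) = 1"
      using K yK by (auto simp: symplectic_subspace_def)
    have zc: "z \<in> carrier_vec (2 * n)" and Rz: "?R *\<^sub>v z = 0\<^sub>v (2 * n)"
      using mat_kernelD[OF Ac z(1)] psd_sqrt_kernel[OF A] by auto
    have "y \<bullet> (?J *\<^sub>v z) = - (z \<bullet> (?J *\<^sub>v y))" by (rule J_mat_scalar_prod(2)[OF y zc])
    also have "?J *\<^sub>v y = - (?R *\<^sub>v x)" unfolding y_def by (rule J_mat_vec_square[OF Rx])
    also have "z \<bullet> - (?R *\<^sub>v x) = - (z \<bullet> (?R *\<^sub>v x))"
      by (rule scalar_prod_uminus_right) (simp only: carrier_vecD[OF zc] carrier_vecD[OF Rx])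
    also have "z \<bullet> (?R *\<^sub>v x) = x \<bullet> (?R *\<^sub>v z)" by (rule sym_mat_scalar_prod[OF R zc x])
    finally show False using z(2) Rz x by simp
  qed
  then have "?J *\<^sub>v y = 0\<^sub>v (2 * n)" using mult_mat_zero_vec[OF J_mat_carrier] by simp
  then have "- (?R *\<^sub>v x) = 0\<^sub>v (2 * n)" using J_mat_vec_square[OF Rx] by (simp add: y_def)
  then have "?R *\<^sub>v x = 0\<^sub>v (2 * n)" using Rx by (metis uminus_uminus_vec uminus_zero_vec)
  then show ?thesis using psd_sqrt_kernel[OF A x] by simp
qed

section \<open>The normal form of \<open>R J R\<close>: entries, existence, columns\<close>

lemma skew_of_conjugate:
  assumes A: "sym_psd_mat (2 * n) A" and Q: "Q \<in> carrier_mat (2 * n) (2 * n)"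
  shows "Q\<^sup>T * psd_sqrt A * J_mat n * psd_sqrt A * Q = Q\<^sup>T * skew_of n A * Q"
proof -
  let ?R = "psd_sqrt A" and ?J = "J_mat n"
  note R = psd_sqrt_carrier(1)[OF A] and J = J_mat_carrier[of n]
  have QT: "Q\<^sup>T \<in> carrier_mat (2 * n) (2 * n)" using Q by simp
  have RJ: "?R * ?J \<in> carrier_mat (2 * n) (2 * n)" by (rule mult_carrier_mat[OF R J])
  have "Q\<^sup>T * ?R * ?J * ?R = Q\<^sup>T * (?R * ?J) * ?R" using assoc_mult_mat[OF QT R J] by simp
  also have "\<dots> = Q\<^sup>T * skew_of n A" unfolding skew_of_def by (rule assoc_mult_mat[OF QT RJ R])
  finally show ?thesis by simp
qed

text \<open>For an orthonormal family the normal form amounts to its entries. The equivalence serves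
  both to build a normal form and to take a given one apart.\<close>

lemma skew_normal_form_vecs:
  assumes A: "sym_psd_mat (2 * n) A" and mn: "m \<le> n" and on: "orthonormal (2 * n) (2 * n) q"
  shows "skew_normal_form n m A (vecs_mat (2 * n) (2 * n) q) d \<longleftrightarrow>
    (\<forall>i < 2 * n. \<forall>j < 2 * n. q i \<bullet> (skew_of n A *\<^sub>v q j) = skew_entry m d i j) \<and>
    (\<forall>i \<in> {m + 1..n}. 0 < d i) \<and> mono_on {m + 1..n} d"
proof -
  let ?Q = "vecs_mat (2 * n) (2 * n) q"
    and ?L = "diag_block_mat (replicate m (0\<^sub>m 2 2) @ map (\<lambda>i. skew_block (d i)) [m + 1..<n + 1])"
  note M = skew_of_carrier(1)[OF A] and L = skew_diag_index[OF mn, where d = d]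
  have F: "(?Q\<^sup>T * skew_of n A * ?Q) $$ (i, j) = q i \<bullet> (skew_of n A *\<^sub>v q j)"
    if "i < 2 * n" "j < 2 * n" for i j
    using vecs_mat_form_index[OF M] orthonormalD(1)[OF on] that by blast
  have Fc: "?Q\<^sup>T * skew_of n A * ?Q \<in> carrier_mat (2 * n) (2 * n)"
    by (rule carrier_matI) simp_all
  have "?Q\<^sup>T * skew_of n A * ?Q = ?L \<longleftrightarrow>
      (\<forall>i < 2 * n. \<forall>j < 2 * n. q i \<bullet> (skew_of n A *\<^sub>v q j) = skew_entry m d i j)"
    (is "?F = ?L \<longleftrightarrow> _")
  proof
    assume "?F = ?L"
    then show "\<forall>i < 2 * n. \<forall>j < 2 * n. q i \<bullet> (skew_of n A *\<^sub>v q j) = skew_entry m d i j"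
      using F L(2) by metis
  next
    assume *: "\<forall>i < 2 * n. \<forall>j < 2 * n. q i \<bullet> (skew_of n A *\<^sub>v q j) = skew_entry m d i j"
    show "?F = ?L"
    proof (rule eq_matI)
      fix i j assume "i < dim_row ?L" "j < dim_col ?L"
      then have ij: "i < 2 * n" "j < 2 * n" using carrier_matD[OF L(1)] by auto
      show "?F $$ (i, j) = ?L $$ (i, j)" unfolding F[OF ij] L(2)[OF ij] using * ij by blast
    qed (use carrier_matD[OF L(1)] in auto)
  qed
  then show ?thesis
    unfolding skew_normal_form_def skew_of_conjugate[OF A vecs_mat_carrier(1)]
    using vecs_mat_orthogonal[OF on] by blast
qed

text \<open>The construction starts from an orthonormal basis of the kernel of \<open>A\<close>. By
  \<open>skew_of_kernel\<close>, \<open>skew_of n A\<close> is injective on its complement, so the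
  \<open>2 * m\<close> prescribed vectors give the zero blocks and the other \<open>n - m\<close>
  pairs positive values.\<close>

lemma skew_normal_form_exists:
  assumes A: "sym_psd_mat (2 * n) A" and mn: "m \<le> n" and K: "symplectic_subspace n (mat_kernel A)"
    and dim: "kernel.dim (2 * n) A = 2 * m"
  shows "\<exists>Q d. skew_normal_form n m A Q d"
proof -
  let ?M = "skew_of n A"
  note M = skew_of_carrier[OF A]
  obtain q0 where on0: "orthonormal (2 * n) (2 * m) q0" and Aq0: "\<And>i. i < 2 * m \<Longrightarrow> A *\<^sub>v q0 i = 0\<^sub>v (2 * n)"
    and inj: "\<And>x. x \<in> unit_perp (2 * n) (2 * m) q0 \<Longrightarrow> A *\<^sub>v x \<noteq> 0\<^sub>v (2 * n)"
    by (rule orthonormal_kernel_exists[OF A, unfolded dim]) (rule that)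
  have Mq0: "\<forall>i<2*m. ?M *\<^sub>v q0 i = 0\<^sub>v (2 * n)"
  proof (intro allI impI)
    fix i assume i: "i < 2 * m"
    have q: "q0 i \<in> carrier_vec (2 * n)" using orthonormalD(1)[OF on0 i] .
    then have "psd_sqrt A *\<^sub>v q0 i = 0\<^sub>v (2 * n)" using psd_sqrt_kernel[OF A q] Aq0[OF i] by simp
    then show "?M *\<^sub>v q0 i = 0\<^sub>v (2 * n)"
      using M(3)[OF q] mult_mat_zero_vec[OF J_mat_carrier] mult_mat_zero_vec[OF psd_sqrt_carrier(1)[OF A]]
      by simp
  qed
  have injM: "\<forall>x \<in> unit_perp (2 * n) (2 * m) q0. ?M *\<^sub>v x \<noteq> 0\<^sub>v (2 * n)"
    using inj skew_of_kernel[OF A K] by (auto simp: unit_perp_def)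
  obtain q d where on: "orthonormal (2 * n) (2 * n) q" and q0: "\<forall>i<2*m. q i = q0 i"
    and pair: "\<forall>j\<in>{m..<n}. 0 < d j \<and> ?M *\<^sub>v q (2 * j) = (- d j) \<cdot>\<^sub>v q (2 * j + 1) \<and>
       ?M *\<^sub>v q (2 * j + 1) = d j \<cdot>\<^sub>v q (2 * j)"
    and mono: "\<forall>j\<in>{m..<n}. \<forall>i\<in>{m..j}. d i \<le> (d j :: real)"
    using skew_normal_vectors[OF M(1,2) order_refl on0 Mq0 injM mn] by blast
  \<comment> \<open>The pairs are numbered from 0, the values in the normal form from 1.\<close>
  let ?d = "\<lambda>i. d (i - 1)"
  have entries: "q i \<bullet> (?M *\<^sub>v q j) = skew_entry m ?d i j" if ij: "i < 2 * n" "j < 2 * n" for i j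
  proof -
    note qi = orthonormalD[OF on]
    \<comment> \<open>Column \<open>j\<close> belongs to the kernel or is the first or second member
      of pair \<open>k\<close>.\<close>
    consider "j < 2 * m" | k where "j = 2 * k" "k \<in> {m..<n}" | k where "j = 2 * k + 1" "k \<in> {m..<n}"
    proof (cases "j < 2 * m")
      case False
      have "j = 2 * (j div 2) \<or> j = 2 * (j div 2) + 1" by presburger
      moreover have "j div 2 \<in> {m..<n}" using False ij by auto
      ultimately show thesis using that by blast
    qed (use that in blast)
    then show ?thesis
    proof cases
      case 1
      then have "?M *\<^sub>v q j = 0\<^sub>v (2 * n)" using Mq0 q0 by simp
      then show ?thesis using 1 qi(1)[OF ij(1)] by (auto simp: skew_entry_def)
    next
      case (2 k)
      have "2 * k + 1 < 2 * n" using 2 by auto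
      then have "q i \<bullet> (?M *\<^sub>v q j) = - d k * (if i = 2 * k + 1 then 1 else 0)"
        using pair 2 qi(1)[OF ij(1)] qi(1)[of "2 * k + 1"] qi(2)[OF ij(1), of "2 * k + 1"] by simp
      moreover have "i = 2 * k + 1 \<longleftrightarrow> i div 2 = k \<and> odd i" by presburger
      ultimately show ?thesis using 2 by (auto simp: skew_entry_def)
    next
      case (3 k)
      have "2 * k < 2 * n" using 3 by auto
      then have "q i \<bullet> (?M *\<^sub>v q j) = d k * (if i = 2 * k then 1 else 0)"
        using pair 3 qi(1)[OF ij(1)] qi(1)[of "2 * k"] qi(2)[OF ij(1), of "2 * k"] by simp
      moreover have "i = 2 * k \<longleftrightarrow> i div 2 = k \<and> even i" by presburger
      ultimately show ?thesis using 3 by (auto simp: skew_entry_def)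
    qed
  qed
  have "\<forall>i \<in> {m + 1..n}. 0 < ?d i"
  proof
    fix i assume "i \<in> {m + 1..n}"
    then have "i - 1 \<in> {m..<n}" by auto
    then show "0 < ?d i" using pair by blast
  qed
  moreover have "mono_on {m + 1..n} ?d"
  proof (rule mono_onI)
    fix r s assume "r \<in> {m + 1..n}" "s \<in> {m + 1..n}" "r \<le> s"
    then have "s - 1 \<in> {m..<n}" "r - 1 \<in> {m..s - 1}" by auto
    then show "?d r \<le> ?d s" using mono by blast
  qed
  ultimately show ?thesis
    using skew_normal_form_vecs[OF A mn on, of ?d] entries by blast
qed

text \<open>The columns of \<open>Q\<close> are an orthonormal basis, and each column of the normal
  form lists the coefficients of one image under \<open>skew_of n A\<close>. Past the zero blocks it
  has a single nonzero entry.\<close>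

lemma skew_normal_form_cols:
  assumes A: "sym_psd_mat (2 * n) A" and mn: "m \<le> n" and snf: "skew_normal_form n m A Q d"
  shows "orthonormal (2 * n) (2 * n) (col Q)"
    and "j \<in> {m..<n} \<Longrightarrow> skew_of n A *\<^sub>v col Q (2 * j) = (- d (j + 1)) \<cdot>\<^sub>v col Q (2 * j + 1)"
    and "j \<in> {m..<n} \<Longrightarrow> skew_of n A *\<^sub>v col Q (2 * j + 1) = d (j + 1) \<cdot>\<^sub>v col Q (2 * j)"
proof -
  let ?M = "skew_of n A" and ?q = "col Q"
  have Q: "Q \<in> carrier_mat (2 * n) (2 * n)" and QQ: "Q\<^sup>T * Q = 1\<^sub>m (2 * n)"
    using snf by (auto simp: skew_normal_form_def real_orthogonal_mat_def)
  show on: "orthonormal (2 * n) (2 * n) ?q"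
    unfolding orthonormal_def
  proof (intro conjI allI impI)
    fix i j assume ij: "i < 2 * n" "j < 2 * n"
    have "(Q\<^sup>T * Q) $$ (i, j) = ?q i \<bullet> ?q j" using Q ij by simp
    then show "?q i \<bullet> ?q j = (if i = j then 1 else 0)" using QQ ij by simp
  qed (use Q in auto)
  note M = skew_of_carrier[OF A]
  note qi = orthonormalD[OF on]
  have entries: "\<forall>i < 2 * n. \<forall>j < 2 * n. ?q i \<bullet> (?M *\<^sub>v ?q j) = skew_entry m d i j"
    using skew_normal_form_vecs[OF A mn on, of d] snf vecs_mat_col[OF Q] by simp
  \<comment> \<open>If \<open>c\<close> at position \<open>k\<close> is the only coefficient that
    may be nonzero, the difference of the two sides is orthogonal to every column of
    \<open>Q\<close>.\<close>
  have eqI: "?M *\<^sub>v ?q l = c \<cdot>\<^sub>v ?q k"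
    if l: "l < 2 * n" and k: "k < 2 * n" and e: "\<And>i. i < 2 * n \<Longrightarrow> skew_entry m d i l = (if i = k then c else 0)" for l k c
  proof -
    have Mq: "?M *\<^sub>v ?q l \<in> carrier_vec (2 * n)" using M(1) qi(1)[OF l] by simp
    have cq: "c \<cdot>\<^sub>v ?q k \<in> carrier_vec (2 * n)" using qi(1)[OF k] by simp
    have z: "?M *\<^sub>v ?q l - c \<cdot>\<^sub>v ?q k = 0\<^sub>v (2 * n)"
    proof (rule orthonormal_complete[OF on])
      fix i assume i: "i < 2 * n"
      have "?q i \<bullet> (?M *\<^sub>v ?q l - c \<cdot>\<^sub>v ?q k) = ?q i \<bullet> (?M *\<^sub>v ?q l) - ?q i \<bullet> (c \<cdot>\<^sub>v ?q k)"
        by (rule scalar_prod_minus_distrib[OF qi(1)[OF i] Mq cq])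
      also have "\<dots> = 0" using entries e[OF i] i l qi(1)[OF i] qi(1)[OF k] qi(2)[OF i k] by simp
      finally show "?q i \<bullet> (?M *\<^sub>v ?q l - c \<cdot>\<^sub>v ?q k) = 0" .
    qed (use Mq cq in simp)
    show ?thesis
    proof (rule eq_vecI)
      fix i assume "i < dim_vec (c \<cdot>\<^sub>v ?q k)"
      then have i: "i < 2 * n" using Q by simp
      have "(?M *\<^sub>v ?q l - c \<cdot>\<^sub>v ?q k) $ i = (?M *\<^sub>v ?q l) $ i - (c \<cdot>\<^sub>v ?q k) $ i"
        by (rule index_minus_vec) (use i cq Q in simp)
      then show "(?M *\<^sub>v ?q l) $ i = (c \<cdot>\<^sub>v ?q k) $ i" using z i by simp
    qed (use carrier_matD(1)[OF M(1)] Q in simp)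
  qed
  assume j: "j \<in> {m..<n}"
  show "?M *\<^sub>v ?q (2 * j) = (- d (j + 1)) \<cdot>\<^sub>v ?q (2 * j + 1)"
  proof (rule eqI)
    fix i
    have "i = 2 * j + 1 \<longleftrightarrow> i div 2 = j \<and> odd i" by presburger
    then show "skew_entry m d i (2 * j) = (if i = 2 * j + 1 then - d (j + 1) else 0)"
      using j by (auto simp: skew_entry_def)
  qed (use j in auto)
  show "?M *\<^sub>v ?q (2 * j + 1) = d (j + 1) \<cdot>\<^sub>v ?q (2 * j)"
  proof (rule eqI)
    fix i
    have "i = 2 * j \<longleftrightarrow> i div 2 = j \<and> even i" by presburger
    then show "skew_entry m d i (2 * j + 1) = (if i = 2 * j then d (j + 1) else 0)"
      using j by (auto simp: skew_entry_def)
  qed (use j in auto)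
qed

section \<open>Symplectic diagonalisation\<close>

text \<open>Since \<open>J_mat m\<close> squares to minus the identity,
  \<open>- J_mat m * (W\<^sup>T * J_mat n)\<close> is a left inverse of \<open>W\<close>. The
  columns are therefore distinct and independent, and there are as many as the dimension of the
  kernel.\<close>

lemma basis_of_J_form:
  assumes A: "A \<in> carrier_mat (2 * n) (2 * n)" and dim: "kernel.dim (2 * n) A = 2 * m"
    and W: "W \<in> carrier_mat (2 * n) (2 * m)" and J: "W\<^sup>T * J_mat n * W = J_mat m"
    and sub: "set (cols W) \<subseteq> mat_kernel A"
  shows "distinct (cols W)" "kernel.basis (2 * n) A (set (cols W))"
proof -
  define C where "C = - J_mat m * (W\<^sup>T * J_mat n)"
  have WJ: "W\<^sup>T * J_mat n \<in> carrier_mat (2 * m) (2 * n)"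
    using W by (intro mult_carrier_mat[OF _ J_mat_carrier]) simp
  have JC: "- J_mat m \<in> carrier_mat (2 * m) (2 * m)" using J_mat_carrier[of m] by simp
  have C: "C \<in> carrier_mat (2 * m) (2 * n)" unfolding C_def by (rule mult_carrier_mat[OF JC WJ])
  have "C * W = - J_mat m * J_mat m" unfolding C_def using assoc_mult_mat[OF JC WJ W] J by simp
  also have "\<dots> = - (J_mat m * J_mat m)" using carrier_matD[OF J_mat_carrier, of m] by simp
  finally have CW: "C * W = 1\<^sub>m (2 * m)" by (simp add: J_mat_square)
  show dist: "distinct (cols W)" by (rule left_inverse_imp_distinct_cols[OF W C CW])
  interpret kernel "2 * n" "2 * n" A by unfold_locales (rule A)
  show "basis (set (cols W))" by (rule basis_of_left_inverse[OF W C CW dist sub]) (simp add: dim)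
qed

text \<open>\<open>B\<close> parametrises the kernel isometrically, and \<open>M\<close> is the
  symplectic form in these coordinates. As the kernel is symplectic, \<open>M\<close> is injective,
  so its skew normal form has no zero block; rescaling each pair makes the blocks standard.\<close>

lemma symplectic_kernel_basis_exists:
  assumes A: "sym_psd_mat (2 * n) A" and K: "symplectic_subspace n (mat_kernel A)"
    and dim: "kernel.dim (2 * n) A = 2 * m"
  shows "\<exists>W1 W2. symplectic_kernel_basis n m A W1 W2"
proof -
  have Ac: "A \<in> carrier_mat (2 * n) (2 * n)" using A by (simp add: sym_psd_mat_def)
  obtain q0 where on0: "orthonormal (2 * n) (2 * m) q0" and Aq0: "\<And>i. i < 2 * m \<Longrightarrow> A *\<^sub>v q0 i = 0\<^sub>v (2 * n)"
    and range: "\<And>x. x \<in> mat_kernel A \<Longrightarrow>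
      \<exists>t \<in> carrier_vec (2 * m). x = vecs_mat (2 * n) (2 * m) q0 *\<^sub>v t"
    by (rule orthonormal_kernel_exists[OF A, unfolded dim]) (rule that)
  let ?J = "J_mat n"
  define B where "B = vecs_mat (2 * n) (2 * m) q0"
  have B: "B \<in> carrier_mat (2 * n) (2 * m)" and BB: "B\<^sup>T * B = 1\<^sub>m (2 * m)"
    using vecs_mat_orthonormal[OF on0] by (auto simp: B_def)
  have BT: "B\<^sup>T \<in> carrier_mat (2 * m) (2 * n)" using B by simp
  have Bv: "B *\<^sub>v t \<in> carrier_vec (2 * n)" if "t \<in> carrier_vec (2 * m)" for t
    by (rule mult_mat_vec_carrier[OF B that])
  have AB: "A *\<^sub>v (B *\<^sub>v t) = 0\<^sub>v (2 * n)" if t: "t \<in> carrier_vec (2 * m)" for t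
  proof -
    have "A * B = 0\<^sub>m (2 * n) (2 * m)"
    proof (rule mat_col_eqI)
      fix i assume "i < dim_col (0\<^sub>m (2 * n) (2 * m) :: real mat)"
      then have i: "i < 2 * m" by simp
      have "col (A * B) i = A *\<^sub>v q0 i"
        using col_mult2[OF Ac B i] orthonormalD(1)[OF on0 i] i by (simp add: B_def)
      then show "col (A * B) i = col (0\<^sub>m (2 * n) (2 * m)) i" using Aq0[OF i] i by simp
    qed (use Ac B in auto)
    moreover have "0\<^sub>m (2 * n) (2 * m) *\<^sub>v t = 0\<^sub>v (2 * n)" using t by (intro eq_vecI) auto
    ultimately show ?thesis using assoc_mult_mat_vec[OF Ac B t] by simp
  qed
  have BKer: "B *\<^sub>v t \<in> mat_kernel A" if "t \<in> carrier_vec (2 * m)" for t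
    using Bv[OF that] AB[OF that] by (intro mat_kernelI[OF Ac])
  define M where "M = B\<^sup>T * (?J * B)"
  have JB: "?J * B \<in> carrier_mat (2 * n) (2 * m)" by (rule mult_carrier_mat[OF J_mat_carrier B])
  have M: "M \<in> carrier_mat (2 * m) (2 * m)" unfolding M_def by (rule mult_carrier_mat[OF BT JB])
  have Mv: "M *\<^sub>v t = B\<^sup>T *\<^sub>v (?J *\<^sub>v (B *\<^sub>v t))" if "t \<in> carrier_vec (2 * m)" for t
    unfolding M_def assoc_mult_mat_vec[OF BT JB that] assoc_mult_mat_vec[OF J_mat_carrier B that] ..
  have form: "(B *\<^sub>v s) \<bullet> (?J *\<^sub>v (B *\<^sub>v t)) = s \<bullet> (M *\<^sub>v t)"
    if "s \<in> carrier_vec (2 * m)" "t \<in> carrier_vec (2 * m)" for s t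
    unfolding Mv[OF that(2)]
    using scalar_prod_mult_mat_vec[OF BT that(1), of "?J *\<^sub>v (B *\<^sub>v t)"] Bv[OF that(2)] by simp
  have skew: "M\<^sup>T = - M"
  proof -
    have "M\<^sup>T = (?J * B)\<^sup>T * B" unfolding M_def using transpose_mult[OF BT JB] by simp
    also have "(?J * B)\<^sup>T = B\<^sup>T * - ?J" using transpose_mult[OF J_mat_carrier B] by (simp add: J_mat_transpose)
    also have "B\<^sup>T * - ?J * B = B\<^sup>T * (- ?J * B)"
      by (rule assoc_mult_mat[OF BT _ B]) (use J_mat_carrier[of n] in simp)
    also have "\<dots> = - M" unfolding M_def using B carrier_matD[OF J_mat_carrier, of n] by simp
    finally show ?thesis .
  qed
  have inj: "M *\<^sub>v x \<noteq> 0\<^sub>v (2 * m)" if x: "x \<in> carrier_vec (2 * m)" "x \<bullet> x = 1" for x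
  proof
    assume 0: "M *\<^sub>v x = 0\<^sub>v (2 * m)"
    have "B *\<^sub>v x \<noteq> 0\<^sub>v (2 * n)"
    proof
      assume "B *\<^sub>v x = 0\<^sub>v (2 * n)"
      then have "(B\<^sup>T * B) *\<^sub>v x = 0\<^sub>v (2 * m)"
        using assoc_mult_mat_vec[OF BT B x(1)] mult_mat_zero_vec[OF BT] by simp
      then show False using BB x by simp
    qed
    \<comment> \<open>A symplectic partner of \<open>B *\<^sub>v x\<close> has the form
      \<open>B *\<^sub>v t\<close>, but the pairing is then
      \<open>- (t \<bullet> (M *\<^sub>v x)) = 0\<close> instead of 1.\<close>
    then obtain y where "y \<in> mat_kernel A" and y: "(B *\<^sub>v x) \<bullet> (?J *\<^sub>v y) = 1"
      using K BKer[OF x(1)] by (auto simp: symplectic_subspace_def)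
    then obtain t where t: "t \<in> carrier_vec (2 * m)" "y = B *\<^sub>v t" using range B_def by blast
    have "(B *\<^sub>v x) \<bullet> (?J *\<^sub>v y) = x \<bullet> (M *\<^sub>v t)" using form[OF x(1) t(1)] t(2) by simp
    also have "\<dots> = - (t \<bullet> (M *\<^sub>v x))" by (rule skew_mat_scalar_prod(2)[OF M skew x(1) t(1)])
    finally show False using y 0 t(1) by simp
  qed
  \<comment> \<open>This is the case \<open>r = 0\<close>: the family starts empty and consists of
    \<open>m\<close> pairs.\<close>
  have "\<exists>q d. orthonormal (2 * m) (2 * m) q \<and> (\<forall>i<2*0. q i = q0 i) \<and>
    (\<forall>j\<in>{0..<m}. 0 < d j \<and> M *\<^sub>v q (2 * j) = (- d j) \<cdot>\<^sub>v q (2 * j + 1) \<and>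
       M *\<^sub>v q (2 * j + 1) = d j \<cdot>\<^sub>v q (2 * j)) \<and>
    (\<forall>j\<in>{0..<m}. \<forall>i\<in>{0..j}. d i \<le> (d j :: real)) \<and>
    (\<forall>j\<in>{0..<m}. \<forall>y \<in> unit_perp (2 * m) (2 * m) q. (d j)\<^sup>2 \<le> y \<bullet> (M\<^sup>T * M *\<^sub>v y))"
    by (rule skew_normal_vectors[OF M skew order_refl])
      (use inj in \<open>auto simp: orthonormal_def unit_perp_def\<close>)
  then obtain q d where on: "orthonormal (2 * m) (2 * m) q"
    and pair: "\<forall>j\<in>{0..<m}. 0 < d j \<and> M *\<^sub>v q (2 * j) = (- d j) \<cdot>\<^sub>v q (2 * j + 1) \<and>
       M *\<^sub>v q (2 * j + 1) = d j \<cdot>\<^sub>v q (2 * j)" by blast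
  note qi = orthonormalD[OF on]
  \<comment> \<open>First members of the pairs go to \<open>W1\<close>, second members to
    \<open>W2\<close>; the two factors \<open>1 / sqrt (d i)\<close> cancel the \<open>d i\<close>
    of the block.\<close>
  define a b where "a = (\<lambda>i. B *\<^sub>v ((1 / sqrt (d i)) \<cdot>\<^sub>v q (2 * i)))"
    and "b = (\<lambda>i. B *\<^sub>v ((1 / sqrt (d i)) \<cdot>\<^sub>v q (2 * i + 1)))"
  have qc: "q (2 * i) \<in> carrier_vec (2 * m)" "q (2 * i + 1) \<in> carrier_vec (2 * m)" if "i < m" for i
    using qi(1) that by auto
  have ac: "a i \<in> carrier_vec (2 * n)" and bc: "b i \<in> carrier_vec (2 * n)"
    and aK: "a i \<in> mat_kernel A" and bK: "b i \<in> mat_kernel A" if "i < m" for i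
    using Bv BKer qc[OF that] by (auto simp: a_def b_def)
  let ?W = "vecs_mat (2 * n) (2 * m) (join_vecs m a b)"
  have J: "?W\<^sup>T * ?J * ?W = J_mat m"
  proof (rule iffD2[OF vecs_mat_J_form])
    show "\<forall>i<m. \<forall>j<m. a i \<bullet> (?J *\<^sub>v a j) = 0 \<and> a i \<bullet> (?J *\<^sub>v b j) = (if i = j then 1 else 0) \<and>
        b i \<bullet> (?J *\<^sub>v a j) = (if i = j then - 1 else 0) \<and> b i \<bullet> (?J *\<^sub>v b j) = 0"
    proof (intro allI impI)
      fix i j assume ij: "i < m" "j < m"
      have p: "0 < d j" "M *\<^sub>v q (2 * j) = (- d j) \<cdot>\<^sub>v q (2 * j + 1)" "M *\<^sub>v q (2 * j + 1) = d j \<cdot>\<^sub>v q (2 * j)"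
        using pair ij by auto
      have f: "(B *\<^sub>v (x \<cdot>\<^sub>v q k)) \<bullet> (?J *\<^sub>v (B *\<^sub>v (y \<cdot>\<^sub>v q l))) = x * (y * (q k \<bullet> (M *\<^sub>v q l)))"
        if "k < 2 * m" "l < 2 * m" for x y k l
        using form[of "x \<cdot>\<^sub>v q k" "y \<cdot>\<^sub>v q l"] qi(1)[OF that(1)] qi(1)[OF that(2)] M
        by (simp add: mult_mat_vec[OF M])
      have l: "2 * i < 2 * m" "2 * i + 1 < 2 * m" "2 * j < 2 * m" "2 * j + 1 < 2 * m" using ij by auto
      have par: "2 * i \<noteq> 2 * j + 1" "2 * i + 1 \<noteq> 2 * j" by presburger+
      show "a i \<bullet> (?J *\<^sub>v a j) = 0 \<and> a i \<bullet> (?J *\<^sub>v b j) = (if i = j then 1 else 0) \<and>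
        b i \<bullet> (?J *\<^sub>v a j) = (if i = j then - 1 else 0) \<and> b i \<bullet> (?J *\<^sub>v b j) = 0"
        unfolding a_def b_def f[OF l(1,3)] f[OF l(1,4)] f[OF l(2,3)] f[OF l(2,4)] p(2,3)
        using qc[OF ij(1)] qc[OF ij(2)] par qi(2)[OF l(1,3)] qi(2)[OF l(1,4)] qi(2)[OF l(2,3)] qi(2)[OF l(2,4)] p(1)
        by (auto simp: field_simps)
    qed
  qed (use ac bc in auto)
  have sub: "set (cols ?W) \<subseteq> mat_kernel A"
  proof
    fix x assume "x \<in> set (cols ?W)"
    then obtain i where i: "i < 2 * m" "x = col ?W i" by (auto simp: cols_def)
    have "join_vecs m a b i \<in> carrier_vec (2 * n)" "join_vecs m a b i \<in> mat_kernel A"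
      using i(1) ac bc aK bK by (auto simp: join_vecs_def)
    then show "x \<in> mat_kernel A" using i by simp
  qed
  have "?W = vecs_mat (2 * n) m a @\<^sub>c vecs_mat (2 * n) m b"
    using append_cols_vecs_mat[of m a "2 * n" m b] ac bc by (simp add: mult_2)
  then have "symplectic_kernel_basis n m A (vecs_mat (2 * n) m a) (vecs_mat (2 * n) m b)"
    unfolding symplectic_kernel_basis_def Let_def
    using basis_of_J_form[OF Ac dim vecs_mat_carrier(1) J sub] J by simp
  then show ?thesis by blast
qed

text \<open>Each column of the block matrix is a multiple of one unit vector; \<open>P_mat n\<close>
  sends position \<open>p\<close> to \<open>2 * p\<close> and \<open>n + p\<close> to
  \<open>2 * p + 1\<close>, and \<open>Q\<close> then picks that column. So the lower block
  \<open>E\<close> yields the odd columns of \<open>Q\<close>, counted from 0, for the first half,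
  and the upper block \<open>- E\<close> the even ones for the second half.\<close>

lemma S_tilde_eq_vecs_mat:
  assumes A: "sym_psd_mat (2 * n) A" and mn: "m \<le> n" and Q: "Q \<in> carrier_mat (2 * n) (2 * n)"
  shows "S_tilde n m A Q d = vecs_mat (2 * n) (2 * (n - m)) (join_vecs (n - m)
     (\<lambda>i. (1 / sqrt (d (m + 1 + i))) \<cdot>\<^sub>v (J_mat n *\<^sub>v (psd_sqrt A *\<^sub>v col Q (2 * (m + i) + 1))))
     (\<lambda>i. (- 1 / sqrt (d (m + 1 + i))) \<cdot>\<^sub>v (J_mat n *\<^sub>v (psd_sqrt A *\<^sub>v col Q (2 * (m + i))))))"
    (is "_ = vecs_mat _ _ (join_vecs _ ?s1 ?s2)")
proof -
  let ?k = "n - m" and ?R = "psd_sqrt A" and ?J = "J_mat n" and ?P = "P_mat n"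
    and ?e = "\<lambda>i. 1 / sqrt (d (m + 1 + i))"
  have km: "m + ?k = n" using mn by simp
  note R = psd_sqrt_carrier(1)[OF A] and J = J_mat_carrier[of n]
  have P: "?P \<in> carrier_mat (2 * n) (2 * n)"
    unfolding P_mat_def by (rule carrier_matI) simp_all
  have Pu: "?P *\<^sub>v unit_vec (2 * n) i = unit_vec (2 * n) (2 * i)"
    "?P *\<^sub>v unit_vec (2 * n) (n + i) = unit_vec (2 * n) (2 * i + 1)" if "i < n" for i
    using mult_mat_unit_vec[OF P, of i] mult_mat_unit_vec[OF P, of "n + i"] that
    by (auto simp: P_mat_def nth_append)
  define U where "U = four_block_mat (0\<^sub>m m ?k) (0\<^sub>m m ?k) (0\<^sub>m ?k ?k) (- E_mat n m d)"
  define V where "V = four_block_mat (0\<^sub>m m ?k) (0\<^sub>m m ?k) (E_mat n m d) (0\<^sub>m ?k ?k)"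
  have Ei: "E_mat n m d $$ (i, j) = (if i = j then ?e j else 0)" if "i < ?k" "j < ?k" for i j
    using that by (simp add: E_mat_def mat_diag_def)
  have E: "E_mat n m d \<in> carrier_mat ?k ?k" by (simp add: E_mat_def)
  have U: "U \<in> carrier_mat n (2 * ?k)" and V: "V \<in> carrier_mat n (2 * ?k)"
    using four_block_carrier_mat[of "0\<^sub>m m ?k" m ?k "- E_mat n m d" ?k ?k "0\<^sub>m m ?k" "0\<^sub>m ?k ?k"] E km
      four_block_carrier_mat[of "0\<^sub>m m ?k" m ?k "0\<^sub>m ?k ?k" ?k ?k "0\<^sub>m m ?k" "E_mat n m d"]
    by (auto simp: U_def V_def mult_2)
  have X: "U @\<^sub>r V \<in> carrier_mat (2 * n) (2 * ?k)"
    using carrier_append_rows[OF U V] by (simp add: mult_2)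
  have Xi: "(U @\<^sub>r V) $$ (i, j) = (if i < n then U $$ (i, j) else V $$ (i - n, j))"
    if "i < 2 * n" "j < 2 * ?k" for i j
    unfolding append_rows_def using that U V by (subst index_mat_four_block) auto
  have Ui: "U $$ (i, j) = (if ?k \<le> j \<and> i = m + (j - ?k) then - ?e (j - ?k) else 0)"
    if "i < n" "j < 2 * ?k" for i j
  proof -
    have "U $$ (i, j) = (if i < m then 0 else if j < ?k then 0 else - E_mat n m d $$ (i - m, j - ?k))"
      unfolding U_def using that E by (subst index_mat_four_block) auto
    then show ?thesis using that Ei[of "i - m" "j - ?k"] by auto
  qed
  have Vi: "V $$ (i, j) = (if j < ?k \<and> i = m + j then ?e j else 0)"
    if "i < n" "j < 2 * ?k" for i j
  proof -
    have "V $$ (i, j) = (if i < m then 0 else if j < ?k then E_mat n m d $$ (i - m, j) else 0)"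
      unfolding V_def using that E by (subst index_mat_four_block) auto
    then show ?thesis using that Ei[of "i - m" j] by auto
  qed
  \<comment> \<open>Column \<open>i\<close> meets only \<open>E\<close> in the lower half, column
    \<open>?k + i\<close> only \<open>- E\<close> in the upper half; the shift by \<open>m\<close>
    skips the zero rows.\<close>
  have colX: "col (U @\<^sub>r V) i = ?e i \<cdot>\<^sub>v unit_vec (2 * n) (n + (m + i))"
    "col (U @\<^sub>r V) (?k + i) = (- ?e i) \<cdot>\<^sub>v unit_vec (2 * n) (m + i)" if "i < ?k" for i
    using that X by (auto intro!: eq_vecI simp: Xi Ui Vi unit_vec_def)
  have JR: "?J * ?R \<in> carrier_mat (2 * n) (2 * n)" by (rule mult_carrier_mat[OF J R])
  have JRQ: "?J * ?R * Q \<in> carrier_mat (2 * n) (2 * n)" by (rule mult_carrier_mat[OF JR Q])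
  define Z where "Z = ?J * ?R * Q * ?P"
  have Z: "Z \<in> carrier_mat (2 * n) (2 * n)" unfolding Z_def by (rule mult_carrier_mat[OF JRQ P])
  have Zv: "Z *\<^sub>v x = ?J *\<^sub>v (?R *\<^sub>v (Q *\<^sub>v (?P *\<^sub>v x)))" if x: "x \<in> carrier_vec (2 * n)" for x
  proof -
    have Px: "?P *\<^sub>v x \<in> carrier_vec (2 * n)" by (rule mult_mat_vec_carrier[OF P x])
    have QPx: "Q *\<^sub>v (?P *\<^sub>v x) \<in> carrier_vec (2 * n)" by (rule mult_mat_vec_carrier[OF Q Px])
    show ?thesis
      unfolding Z_def assoc_mult_mat_vec[OF JRQ P x] assoc_mult_mat_vec[OF JR Q Px]
      by (rule assoc_mult_mat_vec[OF J R QPx])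
  qed
  have Zu: "Z *\<^sub>v unit_vec (2 * n) i = ?J *\<^sub>v (?R *\<^sub>v col Q (2 * i))"
    "Z *\<^sub>v unit_vec (2 * n) (n + i) = ?J *\<^sub>v (?R *\<^sub>v col Q (2 * i + 1))" if i: "i < n" for i
    using Zv[of "unit_vec (2 * n) i"] Zv[of "unit_vec (2 * n) (n + i)"] Pu[OF i]
      mult_mat_unit_vec[OF Q, of "2 * i"] mult_mat_unit_vec[OF Q, of "2 * i + 1"] i by auto
  have St: "S_tilde n m A Q d = Z * (U @\<^sub>r V)"
    by (simp add: S_tilde_def Let_def Z_def U_def V_def)
  show ?thesis unfolding St
  proof (rule mat_col_eqI)
    fix i assume "i < dim_col (vecs_mat (2 * n) (2 * ?k) (join_vecs ?k ?s1 ?s2))"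
    then have i: "i < 2 * ?k" by simp
    have Rq: "?J *\<^sub>v (?R *\<^sub>v col Q j) \<in> carrier_vec (2 * n)" for j
      by (intro J_mat_vec_carrier mult_mat_vec_carrier[OF R] carrier_vecI) (use Q in simp)
    have l: "col (Z * (U @\<^sub>r V)) i = Z *\<^sub>v col (U @\<^sub>r V) i" by (rule col_mult2[OF Z X i])
    have r: "col (vecs_mat (2 * n) (2 * ?k) (join_vecs ?k ?s1 ?s2)) i = join_vecs ?k ?s1 ?s2 i"
      by (rule col_vecs_mat[OF i]) (use Rq i in \<open>auto simp: join_vecs_def\<close>)
    show "col (Z * (U @\<^sub>r V)) i = col (vecs_mat (2 * n) (2 * ?k) (join_vecs ?k ?s1 ?s2)) i"
    proof (cases "i < ?k")
      case True
      then have mi: "m + i < n" by simp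
      show ?thesis unfolding l r colX(1)[OF True] mult_mat_vec[OF Z unit_vec_carrier] Zu(2)[OF mi]
        using True by (simp add: join_vecs_def)
    next
      case False
      define j where "j = i - ?k"
      have j: "j < ?k" "i = ?k + j" "m + j < n" using False i by (auto simp: j_def)
      show ?thesis unfolding l r unfolding j(2) colX(2)[OF j(1)] mult_mat_vec[OF Z unit_vec_carrier] Zu(1)[OF j(3)]
        by (simp add: join_vecs_def)
    qed
  qed (use Z X in simp_all)
qed

text \<open>The four blocks are regrouped into two halves of width \<open>n\<close>,
  \<open>[W1 S1]\<close> and \<open>[W2 S2]\<close>, the shape in which the block identities are
  read off.\<close>

lemma S_mat_eq_vecs_mat:
  assumes "S_tilde n m A Q d = vecs_mat (2 * n) (2 * (n - m)) (join_vecs (n - m) s1 s2)" and mn: "m \<le> n"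
    and W: "W1 \<in> carrier_mat (2 * n) m" "W2 \<in> carrier_mat (2 * n) m"
    and s: "\<And>i. i < n - m \<Longrightarrow> s1 i \<in> carrier_vec (2 * n)" "\<And>i. i < n - m \<Longrightarrow> s2 i \<in> carrier_vec (2 * n)"
  shows "S_mat n m A W1 W2 Q d = vecs_mat (2 * n) (2 * n)
    (join_vecs n (join_vecs m (col W1) s1) (join_vecs m (col W2) s2))"
proof -
  let ?k = "n - m" and ?N = "2 * n"
  have km: "m + ?k = n" using mn by simp
  have "set (map (join_vecs ?k s1 s2) [0..<2 * ?k]) \<subseteq> carrier_vec ?N"
    using s by (auto simp: join_vecs_def)
  then have "cols (S_tilde n m A Q d) = map (join_vecs ?k s1 s2) [0..<2 * ?k]"
    unfolding assms(1) vecs_mat_def by (rule cols_mat_of_cols)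
  then have T: "take ?k (cols (S_tilde n m A Q d)) = map s1 [0..<?k]"
    "drop ?k (cols (S_tilde n m A Q d)) = map s2 [0..<?k]"
    by (auto intro!: nth_equalityI simp: join_vecs_def)
  have w: "col W1 i \<in> carrier_vec ?N" "col W2 i \<in> carrier_vec ?N" for i
    using W by (auto intro!: carrier_vecI)
  have "S_mat n m A W1 W2 Q d = vecs_mat ?N m (col W1) @\<^sub>c vecs_mat ?N ?k s1 @\<^sub>c
      vecs_mat ?N m (col W2) @\<^sub>c vecs_mat ?N ?k s2"
    unfolding S_mat_def Let_def T vecs_mat_col[OF W(1)] vecs_mat_col[OF W(2)] by (simp add: vecs_mat_def)
  also have "vecs_mat ?N m (col W2) @\<^sub>c vecs_mat ?N ?k s2 = vecs_mat ?N n (join_vecs m (col W2) s2)"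
    using append_cols_vecs_mat[of m "col W2" ?N ?k s2] w s km by simp
  also have "vecs_mat ?N ?k s1 @\<^sub>c \<dots> = vecs_mat ?N (?k + n) (join_vecs ?k s1 (join_vecs m (col W2) s2))"
    by (rule append_cols_vecs_mat) (use s w in \<open>auto simp: join_vecs_def\<close>)
  also have "vecs_mat ?N m (col W1) @\<^sub>c \<dots> =
      vecs_mat ?N (m + (?k + n)) (join_vecs m (col W1) (join_vecs ?k s1 (join_vecs m (col W2) s2)))"
    by (rule append_cols_vecs_mat) (use s w in \<open>auto simp: join_vecs_def\<close>)
  also have "m + (?k + n) = 2 * n" using mn by simp
  also have "join_vecs m (col W1) (join_vecs ?k s1 (join_vecs m (col W2) s2)) =
      join_vecs n (join_vecs m (col W1) s1) (join_vecs m (col W2) s2)"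
    using mn by (auto simp: join_vecs_def fun_eq_iff)
  finally show ?thesis .
qed

text \<open>The columns are kernel vectors and scaled vectors \<open>g p\<close>. Mixed pairings
  vanish, kernel vectors pair under \<open>J_mat n\<close> as prescribed for \<open>W\<close> and to
  zero under \<open>A\<close>, and the pairings of the \<open>g p\<close> follow from the action of
  \<open>skew_of n A\<close> on the columns of \<open>Q\<close>.\<close>

lemma symplectic_diagonalization:
  assumes mn: "m \<le> n" and A: "sym_psd_mat (2 * n) A"
    and W: "symplectic_kernel_basis n m A W1 W2" and snf: "skew_normal_form n m A Q d"
  defines "S \<equiv> S_mat n m A W1 W2 Q d" and "D \<equiv> D_mat n m d"
  shows "symplectic_mat n S" "S\<^sup>T * A * S = four_block_mat D (0\<^sub>m n n) (0\<^sub>m n n) D"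
proof -
  let ?R = "psd_sqrt A" and ?J = "J_mat n" and ?M = "skew_of n A" and ?N = "2 * n"
  have Ac: "A \<in> carrier_mat ?N ?N" and As: "A\<^sup>T = A" using A by (auto simp: sym_psd_mat_def)
  note R = psd_sqrt_carrier[OF A] and M = skew_of_carrier[OF A]
  have Q: "Q \<in> carrier_mat ?N ?N" using snf by (simp add: skew_normal_form_def real_orthogonal_mat_def)
  have dpos: "0 < d (j + 1)" if "j \<in> {m..<n}" for j using snf that by (simp add: skew_normal_form_def)
  note q = skew_normal_form_cols[OF A mn snf] and qi = orthonormalD[OF skew_normal_form_cols(1)[OF A mn snf]]
  define g where "g p = ?J *\<^sub>v (?R *\<^sub>v col Q p)" for p
  have Rq: "?R *\<^sub>v col Q p \<in> carrier_vec ?N" if "p < ?N" for p using R(1) qi(1)[OF that] by simp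
  have g: "g p \<in> carrier_vec ?N" if "p < ?N" for p using Rq[OF that] by (simp add: g_def)
  \<comment> \<open>Applying \<open>J\<close> to \<open>g r\<close> gives \<open>- R\<close> times
    column \<open>r\<close> of \<open>Q\<close>; then the \<open>J\<close> and the \<open>R\<close>
    inside \<open>g p\<close> are moved across the scalar product.\<close>
  have gJ: "g p \<bullet> (?J *\<^sub>v g r) = col Q p \<bullet> (?M *\<^sub>v col Q r)" if p: "p < ?N" and r: "r < ?N" for p r
  proof -
    have "g p \<bullet> (?J *\<^sub>v g r) = - (g p \<bullet> (?R *\<^sub>v col Q r))"
      unfolding g_def[of r] J_mat_vec_square[OF Rq[OF r]]
      by (rule scalar_prod_uminus_right) (simp only: carrier_vecD[OF g[OF p]] carrier_vecD[OF Rq[OF r]])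
    also have "\<dots> = (?R *\<^sub>v col Q p) \<bullet> (?J *\<^sub>v (?R *\<^sub>v col Q r))"
      unfolding g_def using J_mat_scalar_prod(1)[OF Rq[OF p] Rq[OF r]] by simp
    also have "\<dots> = col Q p \<bullet> (?R *\<^sub>v (?J *\<^sub>v (?R *\<^sub>v col Q r)))"
      using scalar_prod_mult_mat_vec[OF R(1) qi(1)[OF p], of "?J *\<^sub>v (?R *\<^sub>v col Q r)"] R(2) Rq[OF r] by simp
    finally show ?thesis using M(3)[OF qi(1)[OF r]] by simp
  qed
  have gA: "g p \<bullet> (A *\<^sub>v g r) = (?M *\<^sub>v col Q p) \<bullet> (?M *\<^sub>v col Q r)" if p: "p < ?N" and r: "r < ?N" for p r
  proof -
    have Rg: "?R *\<^sub>v g r \<in> carrier_vec ?N" using R(1) g[OF r] by simp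
    have "g p \<bullet> (A *\<^sub>v g r) = g p \<bullet> (?R *\<^sub>v (?R *\<^sub>v g r))" using psd_sqrt_mult_vec[OF A g[OF r]] by simp
    also have "\<dots> = (?R *\<^sub>v g p) \<bullet> (?R *\<^sub>v g r)"
      using scalar_prod_mult_mat_vec[OF R(1) g[OF p] Rg] R(2) by simp
    finally show ?thesis unfolding g_def M(3)[OF qi(1)[OF p]] M(3)[OF qi(1)[OF r]] .
  qed
  define e where "e i = 1 / sqrt (d (m + 1 + i))" for i
  define s1 where "s1 i = e i \<cdot>\<^sub>v g (2 * (m + i) + 1)" for i
  define s2 where "s2 i = (- e i) \<cdot>\<^sub>v g (2 * (m + i))" for i
  have sc: "s1 i \<in> carrier_vec ?N" "s2 i \<in> carrier_vec ?N" if "i < n - m" for i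
    using g that by (auto simp: s1_def s2_def)
  \<comment> \<open>Two scaling factors cancel one value of \<open>d\<close>. The pairing under
    \<open>A\<close> carries its square, so there one factor \<open>d\<close> remains.\<close>
  have ee: "e i * (e i * d (m + 1 + i)) = 1" if "i < n - m" for i
  proof -
    have "0 < d (m + 1 + i)" using dpos[of "m + i"] that by simp
    then show ?thesis by (simp add: e_def field_simps)
  qed
  have ss: "s1 i \<bullet> (?J *\<^sub>v s1 j) = 0" "s1 i \<bullet> (?J *\<^sub>v s2 j) = (if i = j then 1 else 0)"
    "s2 i \<bullet> (?J *\<^sub>v s1 j) = (if i = j then - 1 else 0)" "s2 i \<bullet> (?J *\<^sub>v s2 j) = 0"
    "s1 i \<bullet> (A *\<^sub>v s1 j) = (if i = j then d (m + 1 + j) else 0)" "s1 i \<bullet> (A *\<^sub>v s2 j) = 0"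
    "s2 i \<bullet> (A *\<^sub>v s1 j) = 0" "s2 i \<bullet> (A *\<^sub>v s2 j) = (if i = j then d (m + 1 + j) else 0)"
    if i: "i < n - m" and j: "j < n - m" for i j
  proof -
    have l: "2 * (m + i) < ?N" "2 * (m + i) + 1 < ?N" "2 * (m + j) < ?N" "2 * (m + j) + 1 < ?N"
      using i j by auto
    have mem: "m + i \<in> {m..<n}" "m + j \<in> {m..<n}" using i j by auto
    have par: "2 * (m + i) \<noteq> 2 * (m + j) + 1" "2 * (m + i) + 1 \<noteq> 2 * (m + j)" by presburger+
    note qq = qi(2)[OF l(1,3)] qi(2)[OF l(1,4)] qi(2)[OF l(2,3)] qi(2)[OF l(2,4)]
    note qc = qi(1)[OF l(1)] qi(1)[OF l(2)] qi(1)[OF l(3)] qi(1)[OF l(4)]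
    note Mi = q(2)[OF mem(1)] q(3)[OF mem(1)] and Mj = q(2)[OF mem(2)] q(3)[OF mem(2)]
    have fJ: "(x \<cdot>\<^sub>v g p) \<bullet> (?J *\<^sub>v (y \<cdot>\<^sub>v g r)) = x * (y * (col Q p \<bullet> (?M *\<^sub>v col Q r)))"
      if "p < ?N" "r < ?N" for x y p r
      using gJ[OF that] g[OF that(1)] g[OF that(2)] by (simp add: mult_mat_vec[OF J_mat_carrier])
    have fA: "(x \<cdot>\<^sub>v g p) \<bullet> (A *\<^sub>v (y \<cdot>\<^sub>v g r)) = x * (y * ((?M *\<^sub>v col Q p) \<bullet> (?M *\<^sub>v col Q r)))"
      if "p < ?N" "r < ?N" for x y p r
      using gA[OF that] g[OF that(1)] g[OF that(2)] Ac by (simp add: mult_mat_vec[OF Ac])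
    show "s1 i \<bullet> (?J *\<^sub>v s1 j) = 0" "s1 i \<bullet> (?J *\<^sub>v s2 j) = (if i = j then 1 else 0)"
      "s2 i \<bullet> (?J *\<^sub>v s1 j) = (if i = j then - 1 else 0)" "s2 i \<bullet> (?J *\<^sub>v s2 j) = 0"
      unfolding s1_def s2_def fJ[OF l(1,3)] fJ[OF l(1,4)] fJ[OF l(2,3)] fJ[OF l(2,4)] Mj
      using qq qc par ee[OF j] by auto
    show "s1 i \<bullet> (A *\<^sub>v s1 j) = (if i = j then d (m + 1 + j) else 0)" "s1 i \<bullet> (A *\<^sub>v s2 j) = 0"
      "s2 i \<bullet> (A *\<^sub>v s1 j) = 0" "s2 i \<bullet> (A *\<^sub>v s2 j) = (if i = j then d (m + 1 + j) else 0)"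
      unfolding s1_def s2_def fA[OF l(1,3)] fA[OF l(1,4)] fA[OF l(2,3)] fA[OF l(2,4)] Mi Mj
      using qq qc par ee[OF j] by auto
  qed
  have Wc: "W1 \<in> carrier_mat ?N m" "W2 \<in> carrier_mat ?N m"
    and WJ: "(W1 @\<^sub>c W2)\<^sup>T * ?J * (W1 @\<^sub>c W2) = J_mat m"
    and Wb: "kernel.basis ?N A (set (cols (W1 @\<^sub>c W2)))"
    using W by (auto simp: symplectic_kernel_basis_def Let_def)
  have w: "col W1 i \<in> carrier_vec ?N" "col W2 i \<in> carrier_vec ?N" for i
    using Wc by (auto intro!: carrier_vecI)
  have Weq: "W1 @\<^sub>c W2 = vecs_mat ?N (2 * m) (join_vecs m (col W1) (col W2))"
    using append_cols_vecs_mat[of m "col W1" ?N m "col W2"] w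
    by (simp add: vecs_mat_col[OF Wc(1)] vecs_mat_col[OF Wc(2)] flip: mult_2)
  have ww: "\<forall>i<m. \<forall>j<m. col W1 i \<bullet> (?J *\<^sub>v col W1 j) = 0 \<and>
      col W1 i \<bullet> (?J *\<^sub>v col W2 j) = (if i = j then 1 else 0) \<and>
      col W2 i \<bullet> (?J *\<^sub>v col W1 j) = (if i = j then - 1 else 0) \<and> col W2 i \<bullet> (?J *\<^sub>v col W2 j) = 0"
    using WJ unfolding Weq by (subst (asm) vecs_mat_J_form) (use w in auto)
  have Wsub: "set (cols (W1 @\<^sub>c W2)) \<subseteq> mat_kernel A"
  proof -
    interpret kernel ?N ?N A by unfold_locales (rule Ac)
    show ?thesis using Wb by (simp add: Ker.basis_def)
  qed
  have Aw: "A *\<^sub>v col W1 i = 0\<^sub>v ?N" "A *\<^sub>v col W2 i = 0\<^sub>v ?N" if i: "i < m" for i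
  proof -
    let ?W = "W1 @\<^sub>c W2"
    have "col ?W i = col W1 i" "col ?W (m + i) = col W2 i"
      unfolding Weq using i w by (auto simp: join_vecs_def)
    moreover have "col ?W i \<in> set (cols ?W)" "col ?W (m + i) \<in> set (cols ?W)"
      using i by (auto simp: cols_def Weq)
    ultimately show "A *\<^sub>v col W1 i = 0\<^sub>v ?N" "A *\<^sub>v col W2 i = 0\<^sub>v ?N"
      using Wsub mat_kernelD(2)[OF Ac] by auto
  qed
  \<comment> \<open>By symmetry the pairings reduce to scalar products with
    \<open>?R *\<^sub>v x\<close> or \<open>A *\<^sub>v x\<close>, which are zero.\<close>
  have wg: "x \<bullet> (?J *\<^sub>v g p) = 0" "g p \<bullet> (?J *\<^sub>v x) = 0" "x \<bullet> (A *\<^sub>v g p) = 0"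
    if x: "x \<in> carrier_vec ?N" "A *\<^sub>v x = 0\<^sub>v ?N" and p: "p < ?N" for x p
  proof -
    have Rx: "?R *\<^sub>v x = 0\<^sub>v ?N" using psd_sqrt_kernel[OF A x(1)] x(2) by simp
    have "x \<bullet> (?J *\<^sub>v g p) = - (x \<bullet> (?R *\<^sub>v col Q p))"
      unfolding g_def J_mat_vec_square[OF Rq[OF p]]
      by (rule scalar_prod_uminus_right) (simp only: carrier_vecD[OF x(1)] carrier_vecD[OF Rq[OF p]])
    also have "x \<bullet> (?R *\<^sub>v col Q p) = col Q p \<bullet> (?R *\<^sub>v x)"
      by (rule sym_mat_scalar_prod[OF R x(1) qi(1)[OF p]])
    finally show 1: "x \<bullet> (?J *\<^sub>v g p) = 0" using Rx qi(1)[OF p] by simp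
    show "g p \<bullet> (?J *\<^sub>v x) = 0" using J_mat_scalar_prod(2)[OF g[OF p] x(1)] 1 by simp
    show "x \<bullet> (A *\<^sub>v g p) = 0"
      using sym_mat_scalar_prod[OF Ac As x(1) g[OF p]] x(2) g[OF p] by simp
  qed
  have ws: "x \<bullet> (?J *\<^sub>v s1 i) = 0" "x \<bullet> (?J *\<^sub>v s2 i) = 0" "s1 i \<bullet> (?J *\<^sub>v x) = 0" "s2 i \<bullet> (?J *\<^sub>v x) = 0"
    "x \<bullet> (A *\<^sub>v s1 i) = 0" "x \<bullet> (A *\<^sub>v s2 i) = 0"
    if x: "x \<in> carrier_vec ?N" "A *\<^sub>v x = 0\<^sub>v ?N" and i: "i < n - m" for x i
  proof -
    have l: "2 * (m + i) < ?N" "2 * (m + i) + 1 < ?N" using i by auto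
    show "x \<bullet> (?J *\<^sub>v s1 i) = 0" "x \<bullet> (?J *\<^sub>v s2 i) = 0" "s1 i \<bullet> (?J *\<^sub>v x) = 0" "s2 i \<bullet> (?J *\<^sub>v x) = 0"
      "x \<bullet> (A *\<^sub>v s1 i) = 0" "x \<bullet> (A *\<^sub>v s2 i) = 0"
      unfolding s1_def s2_def mult_mat_vec[OF J_mat_carrier g[OF l(1)]] mult_mat_vec[OF J_mat_carrier g[OF l(2)]]
        mult_mat_vec[OF Ac g[OF l(1)]] mult_mat_vec[OF Ac g[OF l(2)]]
      using wg[OF x l(1)] wg[OF x l(2)] x(1) g[OF l(1)] g[OF l(2)] Ac by simp_all
  qed
  let ?a = "join_vecs m (col W1) s1" and ?b = "join_vecs m (col W2) s2"
  have S: "S = vecs_mat ?N ?N (join_vecs n ?a ?b)"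
    unfolding S_def
    by (rule S_mat_eq_vecs_mat[OF _ mn Wc sc])
      (simp_all add: S_tilde_eq_vecs_mat[OF A mn Q] s1_def[abs_def] s2_def[abs_def] e_def[abs_def] g_def[abs_def])
  have ab: "?a i \<in> carrier_vec ?N" "?b i \<in> carrier_vec ?N" if "i < n" for i
    using that w sc by (auto simp: join_vecs_def)
  have "S\<^sup>T * ?J * S = ?J"
    unfolding S
  proof (rule iffD2[OF vecs_mat_J_form])
    show "\<forall>i<n. \<forall>j<n. ?a i \<bullet> (?J *\<^sub>v ?a j) = 0 \<and> ?a i \<bullet> (?J *\<^sub>v ?b j) = (if i = j then 1 else 0) \<and>
        ?b i \<bullet> (?J *\<^sub>v ?a j) = (if i = j then - 1 else 0) \<and> ?b i \<bullet> (?J *\<^sub>v ?b j) = 0"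
    proof (intro allI impI)
      \<comment> \<open>Four cases: each index belongs to the kernel part or, lowered by
        \<open>m\<close>, to the scaled part.\<close>
      fix i j assume ij: "i < n" "j < n"
      show "?a i \<bullet> (?J *\<^sub>v ?a j) = 0 \<and> ?a i \<bullet> (?J *\<^sub>v ?b j) = (if i = j then 1 else 0) \<and>
        ?b i \<bullet> (?J *\<^sub>v ?a j) = (if i = j then - 1 else 0) \<and> ?b i \<bullet> (?J *\<^sub>v ?b j) = 0"
        using ij ww ss(1-4)[of "i - m" "j - m"] ws(1-4)[OF w(1) Aw(1), of i "j - m"] ws(1-4)[OF w(2) Aw(2), of i "j - m"]
          ws(1-4)[OF w(1) Aw(1), of j "i - m"] ws(1-4)[OF w(2) Aw(2), of j "i - m"]
        by (cases "i < m"; cases "j < m") (auto simp: join_vecs_def)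
    qed
  qed (use ab in auto)
  then show "symplectic_mat n S" unfolding symplectic_mat_def using S by simp
  have D: "D \<in> carrier_mat n n" and Di: "\<And>i j. i < n \<Longrightarrow> j < n \<Longrightarrow>
      D $$ (i, j) = (if i = j then if i < m then 0 else d (i + 1) else 0)"
    by (auto simp: D_def D_mat_def mat_diag_def)
  show "S\<^sup>T * A * S = four_block_mat D (0\<^sub>m n n) (0\<^sub>m n n) D"
    unfolding S
  proof (rule iffD2[OF vecs_mat_form_eq_four_block[OF Ac]])
    show "\<forall>i<n. \<forall>j<n. ?a i \<bullet> (A *\<^sub>v ?a j) = D $$ (i, j) \<and> ?a i \<bullet> (A *\<^sub>v ?b j) = 0\<^sub>m n n $$ (i, j) \<and>
        ?b i \<bullet> (A *\<^sub>v ?a j) = 0\<^sub>m n n $$ (i, j) \<and> ?b i \<bullet> (A *\<^sub>v ?b j) = D $$ (i, j)"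
    proof (intro allI impI)
      fix i j assume ij: "i < n" "j < n"
      show "?a i \<bullet> (A *\<^sub>v ?a j) = D $$ (i, j) \<and> ?a i \<bullet> (A *\<^sub>v ?b j) = 0\<^sub>m n n $$ (i, j) \<and>
        ?b i \<bullet> (A *\<^sub>v ?a j) = 0\<^sub>m n n $$ (i, j) \<and> ?b i \<bullet> (A *\<^sub>v ?b j) = D $$ (i, j)"
      \<comment> \<open>If \<open>j < m\<close>, column \<open>j\<close> of either half lies in the
        kernel of \<open>A\<close>. Otherwise \<open>m + 1 + (j - m) = j + 1\<close> matches the
        index of \<open>d\<close> in \<open>D\<close>.\<close>
      proof (cases "j < m")
        case True
        then have "A *\<^sub>v ?a j = 0\<^sub>v ?N" "A *\<^sub>v ?b j = 0\<^sub>v ?N" using Aw by (auto simp: join_vecs_def)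
        then show ?thesis using ab[OF ij(1)] ij True by (simp add: Di)
      next
        case False
        then show ?thesis
          using ij ss(5-8)[of "i - m" "j - m"] ws(5,6)[OF w(1) Aw(1), of i "j - m"] ws(5,6)[OF w(2) Aw(2), of i "j - m"]
          by (cases "i < m") (auto simp: join_vecs_def Di)
      qed
    qed
  qed (use D ab in auto)
qed

text \<open>The first two conjuncts show that \<open>W\<close> and \<open>Q\<close> exist, so the
  third, which holds for every choice of them, is not vacuous.\<close>

theorem proposition2p2:
  fixes n m :: nat and A :: "real mat"
  assumes "m < n"
    and "sym_psd_mat (2 * n) A"
    and "symplectic_subspace n (mat_kernel A)"
    and "kernel.dim (2 * n) A = 2 * m"
  shows "(\<exists>W1 W2. symplectic_kernel_basis n m A W1 W2) \<and>
    (\<exists>Q d. skew_normal_form n m A Q d) \<and>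
    (\<forall>W1 W2 Q d. symplectic_kernel_basis n m A W1 W2 \<longrightarrow> skew_normal_form n m A Q d \<longrightarrow>
       (let S = S_mat n m A W1 W2 Q d; D = D_mat n m d in
          symplectic_mat n S \<and>
          S\<^sup>T * A * S = four_block_mat D (0\<^sub>m n n) (0\<^sub>m n n) D))"
  using symplectic_kernel_basis_exists[OF assms(2,3,4)]
    skew_normal_form_exists[OF assms(2) less_imp_le[OF assms(1)] assms(3,4)]
    symplectic_diagonalization[OF less_imp_le[OF assms(1)] assms(2)]
  by (simp add: Let_def)

end
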